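(* Let assumption (A) of the context hold for the iterates of the variance-reduced accelerated SGD algorithm $$y_{k+1}=x_k-\alpha(\nabla f(x_k)+w_{k,N_k}),\qquad x_{k+1}=y_{k+1}+\beta(y_{k+1}-y_k),\qquad k\ge0,$$ where $\alpha\in(0,\tfrac1L]$, $\gamma=\sqrt{\alpha\eta}$, $\beta=\tfrac{1-\gamma}{1+\gamma}$, and $N_k=\lceil(k+1)^v\rceil$ with some $v>0$. Then there exists a constant $C(v)>0$ such that $$\mathbb E[f(y_k)]-f^*\le C(v)\,k^{-v}\qquad\forall k\ge1.$$
   Context: Problem: minimize $f(x)=\mathbb E[F(x,\boldsymbol\xi)]$ over $x\in\mathbb R^m$, where $\boldsymbol\xi$ is an $\mathbb R^d$-valued random vector and $F:\mathbb R^m\times\mathbb R^d\to\mathbb R$. Sampled gradients $\nabla F(x,\xi)$ (gradient in $x$) are available. The algorithm starts from $x_0=y_0\in\mathbb R^m$ with positive constants $\alpha,\beta$ and positive integers $N_k$ (batch sizes); $\xi_{j,k}$ ($1\le j\le N_k$, $k\ge 0$) are i.i.d. copies of $\boldsymbol\xi$; $w_{k,N_k}=\frac1{N_k}\sum_{j=1}^{N_k}\nabla F(x_k,\xi_{j,k})-\nabla f(x_k)$; and $\mathcal F_k=\sigma\{x_0,\xi_{j,t}:1\le j\le N_t,\,0\le t\le k-1\}$, so $x_k$ is $\mathcal F_k$-measurable. Assumption (A): (i) $f$ is continuously differentiable on $\mathbb R^m$ and $\|\nabla f(x)-\nabla f(x')\|\le L\|x-x'\|$ for all $x,x'$, with $L>0$;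 (ii) $f$ is $\eta$-strongly convex, $\eta>0$: $(\nabla f(x)-\nabla f(x'))^T(x-x')\ge\eta\|x-x'\|^2$ for all $x,x'$; (iii) there is $\nu>0$ such that for all $k\ge0$ and $1\le j\le N_k$, almost surely $\mathbb E[\nabla F(x_k,\xi_{j,k})\mid\mathcal F_k]=\nabla f(x_k)$ and $\mathbb E[\|\nabla F(x_k,\xi_{j,k})-\nabla f(x_k)\|^2\mid\mathcal F_k]\le\nu^2$. The unique minimizer of $f$ is denoted $x^*$ and $f^*=f(x^* )$. *)

theory Defs
  imports "HOL-Probability.Probability"
begin

definition gradient :: "('a::real_inner \<Rightarrow> real) \<Rightarrow> 'a \<Rightarrow> 'a" where
  "gradient h x = (THE D. GDERIV h x :> D)"

text \<open>The library's conditional expectation is real-valued; for random vectors it is taken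
  componentwise.\<close>

definition vec_cond_exp ::
  "'w measure \<Rightarrow> 'w measure \<Rightarrow> ('w \<Rightarrow> real ^ 'n) \<Rightarrow> 'w \<Rightarrow> real ^ 'n" where
  "vec_cond_exp M G X \<omega> = (\<chi> i. real_cond_exp M G (\<lambda>\<omega>'. X \<omega>' $ i) \<omega>)"

text \<open>The sigma-algebra generated by the initial point and by all samples drawn before
  iteration \<open>k\<close>; the sample with batch index \<open>j\<close> at iteration \<open>t\<close> is \<open>\<xi> j t\<close>.\<close>

definition history ::
  "'w measure \<Rightarrow> ('w \<Rightarrow> real ^ 'm) \<Rightarrow> (nat \<Rightarrow> nat \<Rightarrow> 'w \<Rightarrow> real ^ 'd) \<Rightarrow> (nat \<Rightarrow> nat) \<Rightarrow> nat \<Rightarrow> 'w measure"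
where
  "history M X0 \<xi> N k = sigma (space M)
     ({X0 -` A \<inter> space M | A. A \<in> sets borel} \<union>
      (\<Union>t<k. \<Union>j\<in>{1..N t}. {\<xi> j t -` A \<inter> space M | A. A \<in> sets borel}))"

end

theory Submission
  imports Defs
begin

text \<open>With \<open>v\<^sub>k = x\<^sub>k + (x\<^sub>k - y\<^sub>k) / \<gamma>\<close>, the function
  \<open>V\<^sub>k = f y\<^sub>k - f x\<^sup>* + \<eta> / 2 * (norm (v\<^sub>k - x\<^sup>*))\<^sup>2\<close> satisfies
  \<open>V\<^sub>k\<^sub>+\<^sub>1 \<le> (1 - \<gamma>) * V\<^sub>k + \<alpha> * (norm w\<^sub>k)\<^sup>2 + e\<^sub>k \<bullet> w\<^sub>k\<close> pathwise, where \<open>e\<^sub>k\<close> depends on the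
  history only. The last term has mean zero, and the noises of one batch are uncorrelated, so that
  \<open>w\<^sub>k\<close> has second moment at most \<open>\<nu>\<^sup>2 / N\<^sub>k \<le> \<nu>\<^sup>2 * (k + 1) powr (- v)\<close>. A sequence that is contracted by
  the factor \<open>1 - \<gamma>\<close> up to a polynomially decaying perturbation decays at the rate of the
  perturbation.\<close>

subsection \<open>Smooth and strongly convex functions\<close>

text \<open>The choice of \<open>\<beta>\<close> makes the next auxiliary point a convex combination
  of the old one and the iterate, followed by a gradient step of length
  \<open>\<alpha> / \<gamma>\<close>. The relation
  \<open>\<gamma>\<^sup>2 = \<alpha> * \<eta>\<close> balances the two halves of \<open>V\<close>:
  each contributes half of \<open>\<alpha>\<close> times the squared norm of the sampled gradient,
  and against the descent term only noise survives. The obstacle is probabilistic. The hypotheses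
  centre a sampled gradient only conditionally on the history and only at the random iterate, so
  nothing is said directly about two noises of one batch. They share that iterate; their
  orthogonality needs one sample to be independent of the pair formed by the iterate and the other
  sample. Moreover no moments of the iterates are assumed: square integrability has to be carried
  along from the deterministic start before any expectation can be split.\<close>

lemma GDERIV_gradient:
  fixes h :: "'a::euclidean_space \<Rightarrow> real"
  assumes "h differentiable (at u)"
  shows "GDERIV h u :> gradient h u"
proof -
  obtain h' where h': "(h has_derivative h') (at u)"
    using assms by (auto simp: differentiable_def)
  interpret h': bounded_linear h' by (rule has_derivative_bounded_linear[OF h'])
  \<comment> \<open>The Riesz representative of the derivative. Its existence, with the uniqueness
    shown below, gives the definite description in \<open>gradient\<close> a meaning.\<close>
  have "h' d = d \<bullet> (\<Sum>b\<in>Basis. h' b *\<^sub>R b)" for d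
  proof -
    have "h' d = h' (\<Sum>b\<in>Basis. (d \<bullet> b) *\<^sub>R b)"
      by (simp only: euclidean_representation)
    then show ?thesis
      by (simp add: h'.sum h'.scaleR inner_sum_right mult.commute)
  qed
  then have "h' = (\<lambda>d. d \<bullet> (\<Sum>b\<in>Basis. h' b *\<^sub>R b))" by blast
  then have "GDERIV h u :> (\<Sum>b\<in>Basis. h' b *\<^sub>R b)"
    using h' unfolding gderiv_def by metis
  moreover have "D = D'" if "GDERIV h u :> D" "GDERIV h u :> D'" for D D'
  proof -
    have "(\<lambda>d. d \<bullet> D) = (\<lambda>d. d \<bullet> D')"
      using that unfolding gderiv_def by (rule has_derivative_unique)
    then show ?thesis
      by (metis inner_commute vector_eq_ldot)
  qed
  ultimately have "\<exists>!D. GDERIV h u :> D" by blast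
  then show ?thesis
    unfolding gradient_def by (rule theI')
qed

lemma DERIV_along_line:
  fixes h :: "'a::euclidean_space \<Rightarrow> real"
  assumes "h differentiable (at (u + t *\<^sub>R d))"
  shows "((\<lambda>t. h (u + t *\<^sub>R d)) has_real_derivative gradient h (u + t *\<^sub>R d) \<bullet> d) (at t)"
proof -
  have h: "(h has_derivative (\<lambda>e. e \<bullet> gradient h (u + t *\<^sub>R d))) (at (u + t *\<^sub>R d))"
    using GDERIV_gradient[OF assms] by (simp add: gderiv_def)
  have "((\<lambda>t. u + t *\<^sub>R d) has_derivative (\<lambda>s. s *\<^sub>R d)) (at t)"
    by (auto intro!: derivative_eq_intros)
  from has_derivative_compose[OF this h] show ?thesis
    by (simp add: has_field_derivative_def inner_commute mult_commute_abs)
qed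

text \<open>Subtracting the quadratic with the same initial slope leaves a nonincreasing function.
  Monotonicity stands in for integrating \<open>\<phi>'\<close>, whose integrability is thus never
  at issue; \<open>c\<close> of either sign serves both the upper and the lower bound below.\<close>

lemma le_quadratic_of_deriv_le_linear:
  fixes \<phi> \<phi>' :: "real \<Rightarrow> real"
  assumes "\<And>t. (\<phi> has_real_derivative \<phi>' t) (at t)"
    and "\<And>t. 0 \<le> t \<Longrightarrow> \<phi>' t \<le> \<phi>' 0 + c * t"
  shows "\<phi> 1 \<le> \<phi> 0 + \<phi>' 0 + c / 2"
proof -
  let ?\<psi> = "\<lambda>t. \<phi> t - \<phi>' 0 * t - c / 2 * t\<^sup>2"
  have "?\<psi> 1 \<le> ?\<psi> 0"
  proof (rule DERIV_nonpos_imp_nonincreasing[where f = ?\<psi> and a = 0 and b = 1])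
    fix t :: real
    assume t: "0 \<le> t" "t \<le> 1"
    have "(?\<psi> has_real_derivative \<phi>' t - \<phi>' 0 - c * t) (at t)"
      by (auto intro!: derivative_eq_intros assms(1))
    then show "\<exists>y. (?\<psi> has_real_derivative y) (at t) \<and> y \<le> 0"
      using assms(2)[OF t(1)] by (intro exI[of _ "\<phi>' t - \<phi>' 0 - c * t"]) auto
  qed simp
  then show ?thesis by simp
qed

text \<open>By Cauchy-Schwarz the slope along the segment grows at most at the linear rate
  \<open>L * (norm (u' - u))\<^sup>2\<close>.\<close>

lemma lipschitz_gradient_upper:
  fixes h :: "'a::euclidean_space \<Rightarrow> real"
  assumes diff: "\<And>u. h differentiable (at u)"
    and lip: "\<And>u u'. norm (gradient h u - gradient h u') \<le> L * norm (u - u')"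
  shows "h u' \<le> h u + gradient h u \<bullet> (u' - u) + L / 2 * (norm (u' - u))\<^sup>2"
proof -
  let ?d = "u' - u"
  have "gradient h (u + t *\<^sub>R ?d) \<bullet> ?d \<le> gradient h (u + 0 *\<^sub>R ?d) \<bullet> ?d + L * (norm ?d)\<^sup>2 * t"
    if "0 \<le> t" for t
  proof -
    have "(gradient h (u + t *\<^sub>R ?d) - gradient h u) \<bullet> ?d
        \<le> norm (gradient h (u + t *\<^sub>R ?d) - gradient h u) * norm ?d"
      by (rule norm_cauchy_schwarz)
    also have "\<dots> \<le> (L * norm (t *\<^sub>R ?d)) * norm ?d"
      using lip[of "u + t *\<^sub>R ?d" u] by (intro mult_right_mono) auto
    also have "\<dots> = L * (norm ?d)\<^sup>2 * t"
      using that by (simp add: power2_eq_square)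
    finally show ?thesis by (simp add: inner_diff_left)
  qed
  from le_quadratic_of_deriv_le_linear[OF DERIV_along_line[OF diff] this]
  show ?thesis by simp
qed

text \<open>The same comparison is applied to the negated function. Strong monotonicity between
  \<open>u\<close> and the point at parameter \<open>t\<close> carries a spare factor
  \<open>t\<close>, which can be cancelled only for \<open>t > 0\<close>.\<close>

lemma strongly_monotone_gradient_lower:
  fixes h :: "'a::euclidean_space \<Rightarrow> real"
  assumes diff: "\<And>u. h differentiable (at u)"
    and mono: "\<And>u u'. (gradient h u - gradient h u') \<bullet> (u - u') \<ge> \<eta> * (norm (u - u'))\<^sup>2"
  shows "h u' \<ge> h u + gradient h u \<bullet> (u' - u) + \<eta> / 2 * (norm (u' - u))\<^sup>2"
proof -
  let ?d = "u' - u"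
  have "- (gradient h (u + t *\<^sub>R ?d) \<bullet> ?d)
      \<le> - (gradient h (u + 0 *\<^sub>R ?d) \<bullet> ?d) + - (\<eta> * (norm ?d)\<^sup>2) * t"
    if "0 \<le> t" for t
  proof (cases "t = 0")
    case False
    with that have t: "t > 0" by simp
    have "t * (\<eta> * (norm ?d)\<^sup>2 * t) = \<eta> * (norm (t *\<^sub>R ?d))\<^sup>2"
      by (simp add: power_mult_distrib power2_eq_square)
    also have "\<dots> \<le> t * ((gradient h (u + t *\<^sub>R ?d) - gradient h u) \<bullet> ?d)"
      using mono[where u = "u + t *\<^sub>R ?d" and u' = u] by simp
    finally have "t * (\<eta> * (norm ?d)\<^sup>2 * t) \<le> t * ((gradient h (u + t *\<^sub>R ?d) - gradient h u) \<bullet> ?d)" .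
    then show ?thesis using t by (simp add: inner_diff_left)
  qed simp
  from le_quadratic_of_deriv_le_linear[OF DERIV_minus[OF DERIV_along_line[OF diff]] this]
  show ?thesis by simp
qed

text \<open>\<open>arg_min\<close> is a choice operator and carries no information until some
  minimizer is known to exist. Compactness supplies one on a ball, and growth excludes smaller
  values outside.\<close>

lemma arg_min_le_of_quadratic_growth:
  fixes h :: "'a::euclidean_space \<Rightarrow> real"
  assumes cont: "continuous_on UNIV h" and "\<eta> > 0"
    and growth: "\<And>u. h u \<ge> h 0 + p \<bullet> u + \<eta> / 2 * (norm u)\<^sup>2"
  shows "h (arg_min h (\<lambda>_. True)) \<le> h u"
proof -
  \<comment> \<open>Beyond this radius \<open>\<eta> / 2 * (norm u)\<^sup>2\<close> dominates
    \<open>norm p * norm u\<close>, so that \<open>h u\<close> is at least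
    \<open>h 0\<close>.\<close>
  define R where "R = 2 * norm p / \<eta>"
  have "R \<ge> 0" using \<open>\<eta> > 0\<close> by (simp add: R_def)
  have "\<exists>c\<in>cball 0 R. \<forall>u\<in>cball 0 R. h c \<le> h u"
    using \<open>R \<ge> 0\<close> by (intro continuous_attains_inf continuous_on_subset[OF cont]) auto
  then obtain c where c: "\<And>u. norm u \<le> R \<Longrightarrow> h c \<le> h u"
    by (metis mem_cball_0)
  have "h c \<le> h u" for u
  proof (cases "norm u \<le> R")
    case False
    have "norm p * norm u \<le> \<eta> / 2 * (norm u)\<^sup>2"
    proof -
      have "norm p \<le> \<eta> / 2 * norm u"
        using False \<open>\<eta> > 0\<close> by (simp add: R_def field_simps)
      from mult_right_mono[OF this, of "norm u"] show ?thesis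
        by (simp add: power2_eq_square)
    qed
    moreover have "- (norm p * norm u) \<le> p \<bullet> u"
      using Cauchy_Schwarz_ineq2[of p u] by linarith
    ultimately have "h 0 \<le> h u" using growth[of u] by linarith
    then show ?thesis using c[of 0] \<open>R \<ge> 0\<close> by simp
  qed (rule c)
  then have "is_arg_min h (\<lambda>_. True) c"
    by (auto simp: is_arg_min_def not_less)
  then have "is_arg_min h (\<lambda>_. True) (arg_min h (\<lambda>_. True))"
    unfolding arg_min_def by (rule someI)
  then show ?thesis by (auto simp: is_arg_min_def not_less)
qed

text \<open>Each coordinate is a pointwise limit of difference quotients along a basis vector, which
  inherit joint measurability in point and sample from \<open>F\<close>. Fubini later relies on the
  joint form.\<close>

lemma borel_measurable_gradient:
  fixes F :: "'a::euclidean_space \<Rightarrow> 'b::second_countable_topology \<Rightarrow> real"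
  assumes F: "(\<lambda>(u, z). F u z) \<in> borel_measurable (borel \<Otimes>\<^sub>M borel)"
    and diff: "\<And>u z. (\<lambda>u. F u z) differentiable (at u)"
  shows "(\<lambda>(u, z). gradient (\<lambda>u. F u z) u) \<in> borel_measurable (borel \<Otimes>\<^sub>M borel)"
proof (subst borel_measurable_euclidean_space, intro ballI)
  fix b :: 'a
  assume "b \<in> Basis"
  let ?\<delta> = "\<lambda>n. inverse (real (Suc n))"
  let ?q = "\<lambda>n (u, z). (F (u + ?\<delta> n *\<^sub>R b) z - F u z) / ?\<delta> n"
  show "(\<lambda>p. (case p of (u, z) \<Rightarrow> gradient (\<lambda>u. F u z) u) \<bullet> b) \<in> borel_measurable (borel \<Otimes>\<^sub>M borel)"
  proof (rule borel_measurable_LIMSEQ_real)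
    fix p :: "'a \<times> 'b"
    obtain u z where p: "p = (u, z)" by (cases p)
    have "((\<lambda>t. F (u + t *\<^sub>R b) z) has_real_derivative gradient (\<lambda>u. F u z) (u + 0 *\<^sub>R b) \<bullet> b) (at 0)"
      by (rule DERIV_along_line[OF diff])
    then have "(\<lambda>t. (F (u + t *\<^sub>R b) z - F u z) / t) \<midarrow>0\<rightarrow> gradient (\<lambda>u. F u z) u \<bullet> b"
      by (simp add: DERIV_def)
    moreover have "filterlim ?\<delta> (at 0) sequentially"
      using LIMSEQ_inverse_real_of_nat by (auto simp: filterlim_at)
    ultimately have "(\<lambda>n. (F (u + ?\<delta> n *\<^sub>R b) z - F u z) / ?\<delta> n)
        \<longlonglongrightarrow> gradient (\<lambda>u. F u z) u \<bullet> b"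
      by (rule filterlim_compose)
    then show "(\<lambda>n. ?q n p) \<longlonglongrightarrow> (case p of (u, z) \<Rightarrow> gradient (\<lambda>u. F u z) u) \<bullet> b"
      by (simp add: p)
  next
    fix n
    have shift: "(\<lambda>p. (fst p + ?\<delta> n *\<^sub>R b, snd p)) \<in> borel \<Otimes>\<^sub>M borel \<rightarrow>\<^sub>M borel \<Otimes>\<^sub>M (borel :: 'b measure)"
      by measurable
    have "(\<lambda>p. ((\<lambda>(u, z). F u z) (fst p + ?\<delta> n *\<^sub>R b, snd p) - (\<lambda>(u, z). F u z) p) / ?\<delta> n)
        \<in> borel_measurable (borel \<Otimes>\<^sub>M borel)"
      using measurable_compose[OF shift F] F by measurable
    then show "?q n \<in> borel_measurable (borel \<Otimes>\<^sub>M borel)"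
      by (simp add: case_prod_unfold)
  qed
qed

text \<open>The iterates are eliminated in favour of \<open>x + (x - y) / \<gamma>\<close>, which is the auxiliary point of
  Nesterov's method.\<close>

lemma accelerated_step:
  fixes f :: "'a::euclidean_space \<Rightarrow> real" and x y z w :: 'a
  assumes upper: "\<And>u u'. f u' \<le> f u + gradient f u \<bullet> (u' - u) + L / 2 * (norm (u' - u))\<^sup>2"
    and lower: "\<And>u u'. f u' \<ge> f u + gradient f u \<bullet> (u' - u) + \<eta> / 2 * (norm (u' - u))\<^sup>2"
    and "\<alpha> > 0" "\<eta> > 0" "\<alpha> * L \<le> 1"
    and \<gamma>: "\<gamma>\<^sup>2 = \<alpha> * \<eta>" "0 < \<gamma>" "\<gamma> \<le> 1"
    and \<beta>: "\<beta> = (1 - \<gamma>) / (1 + \<gamma>)"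
    and y': "y' = x - \<alpha> *\<^sub>R (gradient f x + w)"
    and x': "x' = y' + \<beta> *\<^sub>R (y' - y)"
  shows "f y' - f z + \<eta> / 2 * (norm (x' + (1 / \<gamma>) *\<^sub>R (x' - y') - z))\<^sup>2
    \<le> (1 - \<gamma>) * (f y - f z + \<eta> / 2 * (norm (x + (1 / \<gamma>) *\<^sub>R (x - y) - z))\<^sup>2)
      + \<alpha> * (norm w)\<^sup>2 + w \<bullet> (\<alpha> *\<^sub>R gradient f x - \<gamma> *\<^sub>R (x - z) - (1 - \<gamma>) *\<^sub>R (x - y))"
proof -
  define g where "g = gradient f x"
  define G where "G = g + w"
  \<comment> \<open>\<open>D\<close> is the auxiliary point relative to \<open>z\<close>;
    \<open>E\<close> is what it turns into before the gradient step.\<close>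
  define D where "D = x + (1 / \<gamma>) *\<^sub>R (x - y) - z"
  define E where "E = (1 - \<gamma>) *\<^sub>R D + \<gamma> *\<^sub>R (x - z)"
  \<comment> \<open>Scaling by \<open>\<gamma>\<close> clears the division and exposes exactly the
    displacements \<open>x - z\<close> and \<open>x - y\<close>, with the weights that the convexity
    inequalities at \<open>z\<close> and \<open>y\<close> receive below.\<close>
  have \<gamma>E: "\<gamma> *\<^sub>R E = \<gamma> *\<^sub>R (x - z) + (1 - \<gamma>) *\<^sub>R (x - y)"
  proof -
    have "\<gamma> *\<^sub>R D = \<gamma> *\<^sub>R (x - z) + (x - y)"
      using \<gamma> by (simp add: D_def algebra_simps)
    then have "(1 - \<gamma>) *\<^sub>R (\<gamma> *\<^sub>R D) = (1 - \<gamma>) *\<^sub>R (\<gamma> *\<^sub>R (x - z) + (x - y))" by simp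
    then show ?thesis by (simp add: E_def algebra_simps)
  qed
  \<comment> \<open>The momentum enters here: \<open>\<beta> * (1 + \<gamma>) = 1 - \<gamma>\<close>
    turns the extrapolation into the weight that \<open>x - y\<close> has in
    \<open>\<gamma>E\<close>.\<close>
  have D': "x' + (1 / \<gamma>) *\<^sub>R (x' - y') - z = E - (\<alpha> / \<gamma>) *\<^sub>R G"
  proof -
    have "\<beta> * (1 + \<gamma>) = 1 - \<gamma>" using \<gamma> by (simp add: \<beta>)
    then have \<gamma>\<beta>: "(\<gamma> + 1) *\<^sub>R (\<beta> *\<^sub>R u) = (1 - \<gamma>) *\<^sub>R u" for u :: 'a
      by (simp add: mult.commute add.commute)
    have "\<gamma> *\<^sub>R (x' + (1 / \<gamma>) *\<^sub>R (x' - y') - z) = \<gamma> *\<^sub>R (y' - z) + (\<gamma> + 1) *\<^sub>R (\<beta> *\<^sub>R (y' - y))"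
      using \<gamma> by (simp add: x' algebra_simps)
    also have "\<dots> = \<gamma> *\<^sub>R (y' - z) + (1 - \<gamma>) *\<^sub>R (y' - y)" by (simp only: \<gamma>\<beta>)
    also have "\<dots> = \<gamma> *\<^sub>R (E - (\<alpha> / \<gamma>) *\<^sub>R G)"
      using \<gamma> unfolding scaleR_diff_right[of \<gamma> E] \<gamma>E
      by (simp add: y' G_def g_def algebra_simps)
    finally show ?thesis using \<gamma> by simp
  qed
  have sq: "(norm (E - (\<alpha> / \<gamma>) *\<^sub>R G))\<^sup>2 = (norm E)\<^sup>2 - 2 * (\<alpha> / \<gamma>) * (E \<bullet> G) + (\<alpha> / \<gamma>)\<^sup>2 * (norm G)\<^sup>2"
    unfolding power2_norm_eq_inner
    by (simp add: inner_diff_left inner_diff_right inner_commute power2_eq_square algebra_simps)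
  \<comment> \<open>The summation of all estimates below, with the nonlinear terms as opaque variables.\<close>
  have lin: "b - z + d' \<le> r + s + t"
    if "d' = e - eG + nG" "e \<le> m" "b \<le> fx - gG + nG" "\<gamma>fz \<ge> fz'" "\<gamma>fy \<ge> fy'"
      "eG = u1 + u2 + wu" "nn - gG = s + wg" "t = wg - wu" "m = m1 + m2"
      "fz' = \<gamma>fx - u1 + m2" "fy' = fx - \<gamma>fx - u2" "r = \<gamma>fy - (z - \<gamma>fz) + m1" "nG + nG = nn"
    for b z d' r s t e eG nG m fx gG \<gamma>fz fz' \<gamma>fy fy' u1 u2 wu nn wg m1 m2 \<gamma>fx :: real
    using that by linarith
  have "\<eta> / 2 * (norm (E - (\<alpha> / \<gamma>) *\<^sub>R G))\<^sup>2 = \<eta> / 2 * (norm E)\<^sup>2 - (\<gamma> *\<^sub>R E) \<bullet> G + \<alpha> / 2 * (norm G)\<^sup>2"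
  proof -
    \<comment> \<open>The reason for \<open>\<gamma>\<^sup>2 = \<alpha> * \<eta>\<close>: the cross
      term gets coefficient \<open>\<gamma>\<close>, as in \<open>\<gamma>E\<close>, and the square
      gets \<open>\<alpha> / 2\<close>.\<close>
    have \<eta>: "\<eta> * (\<alpha> / \<gamma>) = \<gamma>" using \<gamma> by (simp add: field_simps power2_eq_square)
    then have "\<eta> * (\<alpha> / \<gamma>)\<^sup>2 = \<alpha>"
      using \<gamma>(1,2) \<open>\<eta> > 0\<close> by (simp add: power_divide power2_eq_square)
    have "\<eta> / 2 * (norm (E - (\<alpha> / \<gamma>) *\<^sub>R G))\<^sup>2
      = \<eta> / 2 * (norm E)\<^sup>2 - (\<eta> * (\<alpha> / \<gamma>)) * (E \<bullet> G) + (\<eta> * (\<alpha> / \<gamma>)\<^sup>2) / 2 * (norm G)\<^sup>2"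
      unfolding sq by (simp add: algebra_simps)
    also have "\<dots> = \<eta> / 2 * (norm E)\<^sup>2 - \<gamma> * (E \<bullet> G) + \<alpha> / 2 * (norm G)\<^sup>2"
      unfolding \<open>\<eta> * (\<alpha> / \<gamma>)\<^sup>2 = \<alpha>\<close> \<eta> ..
    finally show ?thesis by simp
  qed
  moreover have "(norm E)\<^sup>2 \<le> (1 - \<gamma>) * (norm D)\<^sup>2 + \<gamma> * (norm (x - z))\<^sup>2"
  proof -
    \<comment> \<open>Convexity of the squared norm, with its defect computed exactly.\<close>
    have "(1 - \<gamma>) * (norm D)\<^sup>2 + \<gamma> * (norm (x - z))\<^sup>2 - (norm E)\<^sup>2
        = \<gamma> * (1 - \<gamma>) * (norm (D - (x - z)))\<^sup>2"
      unfolding E_def power2_norm_eq_inner inner_add_left inner_add_right inner_diff_left[of D "x - z"]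
        inner_diff_right[of _ D "x - z"] inner_scaleR_left inner_scaleR_right
      by (simp only: inner_commute[of "x - z" D]) algebra
    also have "\<dots> \<ge> 0" using \<gamma> by simp
    finally show ?thesis by simp
  qed
  then have "\<eta> / 2 * (norm E)\<^sup>2 \<le> \<eta> / 2 * ((1 - \<gamma>) * (norm D)\<^sup>2 + \<gamma> * (norm (x - z))\<^sup>2)"
    using \<open>\<eta> > 0\<close> by (intro mult_left_mono) auto
  \<comment> \<open>\<open>\<alpha> * L \<le> 1\<close> lowers the quadratic coefficient to
    \<open>\<alpha> / 2\<close>; with the equal coefficient from the distance term it adds up to
    \<open>\<alpha> * (norm G)\<^sup>2\<close>.\<close>
  moreover have "f y' \<le> f x - \<alpha> * (g \<bullet> G) + \<alpha> / 2 * (norm G)\<^sup>2"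
  proof -
    have "f y' \<le> f x - \<alpha> * (g \<bullet> G) + L / 2 * (\<alpha>\<^sup>2 * (norm G)\<^sup>2)"
      using upper[of y' x] by (simp add: y' G_def g_def power_mult_distrib)
    moreover have "L / 2 * (\<alpha>\<^sup>2 * (norm G)\<^sup>2) = (\<alpha> * L) * (\<alpha> / 2 * (norm G)\<^sup>2)"
      by (simp add: power2_eq_square)
    moreover have "\<dots> \<le> 1 * (\<alpha> / 2 * (norm G)\<^sup>2)"
      using \<open>\<alpha> > 0\<close> \<open>\<alpha> * L \<le> 1\<close> by (intro mult_right_mono) auto
    ultimately show ?thesis by linarith
  qed
  \<comment> \<open>At \<open>z\<close> the quadratic term is kept, since it pays for the
    \<open>\<gamma> * (norm (x - z))\<^sup>2\<close> created by convexity of the squared norm; at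
    \<open>y\<close> it is discarded.\<close>
  moreover have "\<gamma> * f z \<ge> \<gamma> * (f x - g \<bullet> (x - z) + \<eta> / 2 * (norm (x - z))\<^sup>2)"
    using lower[where u = x and u' = z] \<gamma>
    by (intro mult_left_mono) (auto simp: g_def inner_diff_right norm_minus_commute[of z x])
  moreover have "(1 - \<gamma>) * f y \<ge> (1 - \<gamma>) * (f x - g \<bullet> (x - y))"
  proof (intro mult_left_mono)
    have "0 \<le> \<eta> / 2 * (norm (y - x))\<^sup>2" using \<open>\<eta> > 0\<close> by simp
    then show "f x - g \<bullet> (x - y) \<le> f y"
      using lower[where u = x and u' = y] unfolding g_def inner_diff_right by linarith
  qed (use \<gamma> in simp)
  moreover have "(\<gamma> *\<^sub>R E) \<bullet> G = \<gamma> * (g \<bullet> (x - z)) + (1 - \<gamma>) * (g \<bullet> (x - y))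
      + w \<bullet> (\<gamma> *\<^sub>R (x - z) + (1 - \<gamma>) *\<^sub>R (x - y))"
    unfolding \<gamma>E G_def by (simp add: inner_add_right inner_add_left inner_commute algebra_simps)
  \<comment> \<open>Because \<open>G - g = w\<close>, the difference is
    \<open>\<alpha> * (w \<bullet> G)\<close>: every term without noise cancels.\<close>
  moreover have "\<alpha> * (norm G)\<^sup>2 - \<alpha> * (g \<bullet> G) = \<alpha> * (norm w)\<^sup>2 + w \<bullet> (\<alpha> *\<^sub>R g)"
    unfolding power2_norm_eq_inner G_def
    by (simp add: inner_add_right inner_add_left inner_commute algebra_simps)
  moreover have "w \<bullet> (\<alpha> *\<^sub>R g - \<gamma> *\<^sub>R (x - z) - (1 - \<gamma>) *\<^sub>R (x - y))
      = w \<bullet> (\<alpha> *\<^sub>R g) - w \<bullet> (\<gamma> *\<^sub>R (x - z) + (1 - \<gamma>) *\<^sub>R (x - y))"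
    by (simp only: inner_diff_right inner_add_right)
  moreover have "\<eta> / 2 * ((1 - \<gamma>) * (norm D)\<^sup>2 + \<gamma> * (norm (x - z))\<^sup>2)
      = \<eta> / 2 * ((1 - \<gamma>) * (norm D)\<^sup>2) + \<eta> / 2 * (\<gamma> * (norm (x - z))\<^sup>2)"
    by (rule distrib_left)
  moreover have "\<gamma> * (f x - g \<bullet> (x - z) + \<eta> / 2 * (norm (x - z))\<^sup>2)
      = \<gamma> * f x - \<gamma> * (g \<bullet> (x - z)) + \<eta> / 2 * (\<gamma> * (norm (x - z))\<^sup>2)"
    by (simp only: distrib_left right_diff_distrib mult.left_commute)
  moreover have "(1 - \<gamma>) * (f x - g \<bullet> (x - y)) = f x - \<gamma> * f x - (1 - \<gamma>) * (g \<bullet> (x - y))"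
    by (simp only: right_diff_distrib left_diff_distrib mult_1)
  moreover have "(1 - \<gamma>) * (f y - f z + \<eta> / 2 * (norm D)\<^sup>2)
      = (1 - \<gamma>) * f y - (f z - \<gamma> * f z) + \<eta> / 2 * ((1 - \<gamma>) * (norm D)\<^sup>2)"
    by (simp only: distrib_left right_diff_distrib left_diff_distrib mult_1 mult.left_commute)
  moreover have "\<alpha> / 2 * (norm G)\<^sup>2 + \<alpha> / 2 * (norm G)\<^sup>2 = \<alpha> * (norm G)\<^sup>2"
    by simp
  ultimately show ?thesis
    unfolding D' D_def[symmetric] g_def[symmetric] by (rule lin)
qed

subsection \<open>Linear contraction with a decaying perturbation\<close>

text \<open>Shifting the index changes \<open>real k powr (- v)\<close> by a factor tending to 1, so
  that a contraction by \<open>q\<close> still dominates the shift once \<open>q\<close> is relaxed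
  to some \<open>p < 1\<close>. From then on the bound reproduces itself.\<close>

lemma contraction_with_polynomial_forcing:
  fixes a :: "nat \<Rightarrow> real"
  assumes step: "\<And>k. a (Suc k) \<le> q * a k + c * (real k + 1) powr (- v)"
    and q: "0 \<le> q" "q < 1" and c: "c \<ge> 0"
  shows "\<exists>C>0. \<forall>k\<ge>1. a k \<le> C * real k powr (- v)"
proof -
  define p where "p = (1 + q) / 2"
  have p: "q < p" "p < 1" using q by (auto simp: p_def)
  have "(\<lambda>k. q * ((real k + 1) / real k) powr v) \<longlonglongrightarrow> q * 1 powr v"
  proof (intro tendsto_intros)
    have "(\<lambda>k. (real (Suc k)) / real k) \<longlonglongrightarrow> 1" by (rule LIMSEQ_Suc_n_over_n)
    then show "(\<lambda>k. (real k + 1) / real k) \<longlonglongrightarrow> 1" by (simp add: add.commute)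
  qed auto
  then have "\<forall>\<^sub>F k in sequentially. q * ((real k + 1) / real k) powr v < p"
    using p by (intro order_tendstoD) auto
  then obtain K0 where K0: "\<And>k. k \<ge> K0 \<Longrightarrow> q * ((real k + 1) / real k) powr v < p"
    by (auto simp: eventually_sequentially)
  \<comment> \<open>The successor keeps the indices of the induction positive, so that dividing by
    \<open>real k\<close> is meaningful.\<close>
  define K where "K = Suc K0"
  \<comment> \<open>The quotient solves \<open>C * p + c \<le> C\<close>, the sum covers the
    finitely many indices up to \<open>K\<close>, and 1 secures positivity.\<close>
  define C where "C = c / (1 - p) + 1 + (\<Sum>k\<le>K. \<bar>a k\<bar> * real k powr v)"
  have sum_nonneg: "(\<Sum>k\<le>K. \<bar>a k\<bar> * real k powr v) \<ge> 0"
    by (intro sum_nonneg) auto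
  have C: "C > 0" "C * p + c \<le> C"
  proof -
    have d: "c / (1 - p) \<ge> 0" using p c by simp
    show "C > 0" unfolding C_def using d sum_nonneg by linarith
    have "c / (1 - p) \<le> C" unfolding C_def using sum_nonneg by linarith
    then have "c \<le> C * (1 - p)" using p by (simp add: field_simps)
    then show "C * p + c \<le> C" by (simp add: algebra_simps)
  qed
  have small: "a k \<le> C * real k powr (- v)" if "1 \<le> k" "k \<le> K" for k
  proof -
    have "\<bar>a k\<bar> * real k powr v \<le> (\<Sum>k\<le>K. \<bar>a k\<bar> * real k powr v)"
      using that by (intro member_le_sum) auto
    also have "\<dots> \<le> C" using p c unfolding C_def by simp
    finally have "a k * real k powr v \<le> C"
      by (smt (verit) mult_right_mono powr_ge_zero abs_ge_self)
    then show ?thesis using that by (simp add: powr_minus field_simps)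
  qed
  have large: "a k \<le> C * real k powr (- v)" if "K \<le> k" for k
    using that
  proof (induction rule: dec_induct)
    case base
    then show ?case by (intro small) (auto simp: K_def)
  next
    case (step k)
    have k: "real k > 0" "k \<ge> K0" using step by (auto simp: K_def)
    have "q * real k powr (- v) = q * ((real k + 1) / real k) powr v * (real k + 1) powr (- v)"
      using k by (simp add: powr_minus powr_divide field_simps)
    also have "\<dots> \<le> p * (real k + 1) powr (- v)"
      using K0[OF k(2)] by (intro mult_right_mono) auto
    finally have qk: "q * real k powr (- v) \<le> p * (real k + 1) powr (- v)" .
    have "a (Suc k) \<le> q * a k + c * (real k + 1) powr (- v)" by (rule assms(1))
    also have "\<dots> \<le> q * (C * real k powr (- v)) + c * (real k + 1) powr (- v)"
      using step q by (intro add_right_mono mult_left_mono) auto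
    also have "\<dots> = C * (q * real k powr (- v)) + c * (real k + 1) powr (- v)" by simp
    also have "\<dots> \<le> C * (p * (real k + 1) powr (- v)) + c * (real k + 1) powr (- v)"
      using qk C by (intro add_right_mono mult_left_mono) auto
    also have "\<dots> = (C * p + c) * (real k + 1) powr (- v)" by (simp add: algebra_simps)
    also have "\<dots> \<le> C * (real k + 1) powr (- v)"
      using C by (intro mult_right_mono) auto
    finally show ?case by (simp add: add.commute)
  qed
  show ?thesis
    using C(1) small large by (meson nat_le_linear)
qed

subsection \<open>Square-integrable random vectors\<close>

text \<open>The space L^2 of vector-valued functions. Measurability is a separate conjunct because
  that of the squared norm does not imply that of \<open>X\<close>.\<close>

definition square_integrable :: "'w measure \<Rightarrow> ('w \<Rightarrow> 'a::euclidean_space) \<Rightarrow> bool" where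
  "square_integrable M X \<longleftrightarrow> X \<in> borel_measurable M \<and> integrable M (\<lambda>\<omega>. (norm (X \<omega>))\<^sup>2)"

lemma square_integrable_measurable [measurable_dest]:
  "square_integrable M X \<Longrightarrow> X \<in> borel_measurable M"
  by (simp add: square_integrable_def)

lemma square_integrable_norm_square:
  "square_integrable M X \<Longrightarrow> integrable M (\<lambda>\<omega>. (norm (X \<omega>))\<^sup>2)"
  by (simp add: square_integrable_def)

lemma square_integrable_bound:
  assumes "square_integrable M Y" and "X \<in> borel_measurable M"
    and "\<And>\<omega>. \<omega> \<in> space M \<Longrightarrow> norm (X \<omega>) \<le> norm (Y \<omega>)"
  shows "square_integrable M X"
  unfolding square_integrable_def
proof
  show "integrable M (\<lambda>\<omega>. (norm (X \<omega>))\<^sup>2)"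
    using assms(2,3)
    by (intro Bochner_Integration.integrable_bound[OF square_integrable_norm_square[OF assms(1)]])
       (auto intro!: AE_I2 power_mono)
qed fact

lemma square_integrable_eqI:
  assumes "\<And>\<omega>. \<omega> \<in> space M \<Longrightarrow> X \<omega> = Y \<omega>" and "square_integrable M Y"
  shows "square_integrable M X"
  using assms(2) measurable_cong[of M X Y borel, OF assms(1)]
    Bochner_Integration.integrable_cong[OF refl, of M "\<lambda>\<omega>. (norm (X \<omega>))\<^sup>2" "\<lambda>\<omega>. (norm (Y \<omega>))\<^sup>2"]
  by (simp add: square_integrable_def assms(1))

lemma square_integrable_scaleR:
  "square_integrable M X \<Longrightarrow> square_integrable M (\<lambda>\<omega>. c *\<^sub>R X \<omega>)"
  by (auto simp: square_integrable_def power_mult_distrib)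

text \<open>The parallelogram law dominates the squared norm of a sum.\<close>

lemma square_integrable_add:
  assumes X: "square_integrable M X" and Y: "square_integrable M Y"
  shows "square_integrable M (\<lambda>\<omega>. X \<omega> + Y \<omega>)"
  unfolding square_integrable_def
proof
  have *: "(norm (x + y))\<^sup>2 \<le> 2 * (norm x)\<^sup>2 + 2 * (norm y)\<^sup>2" for x y :: 'b
  proof -
    have "(norm (x + y))\<^sup>2 + (norm (x - y))\<^sup>2 = 2 * (norm x)\<^sup>2 + 2 * (norm y)\<^sup>2"
      unfolding power2_norm_eq_inner by (simp add: algebra_simps)
    then show ?thesis by (smt (verit) zero_le_power2)
  qed
  show "integrable M (\<lambda>\<omega>. (norm (X \<omega> + Y \<omega>))\<^sup>2)"
  proof (rule Bochner_Integration.integrable_bound)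
    show "integrable M (\<lambda>\<omega>. 2 * (norm (X \<omega>))\<^sup>2 + 2 * (norm (Y \<omega>))\<^sup>2)"
      using X Y by (simp add: square_integrable_def)
  qed (use X Y * in \<open>auto intro!: AE_I2 simp: square_integrable_def\<close>)
qed (use X Y in \<open>auto simp: square_integrable_def\<close>)

lemma square_integrable_diff:
  assumes "square_integrable M X" "square_integrable M Y"
  shows "square_integrable M (\<lambda>\<omega>. X \<omega> - Y \<omega>)"
  using square_integrable_add[OF assms(1) square_integrable_scaleR[OF assms(2), of "- 1"]] by simp

lemma square_integrable_sum:
  "(\<And>i. i \<in> I \<Longrightarrow> square_integrable M (X i)) \<Longrightarrow> square_integrable M (\<lambda>\<omega>. \<Sum>i\<in>I. X i \<omega>)"
proof (induction I rule: infinite_finite_induct)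
  case (insert i I)
  then show ?case by (simp add: square_integrable_add)
qed (auto simp: square_integrable_def)

text \<open>Polarization expresses the product through three squared norms, each integrable by
  closure under sums.\<close>

lemma integrable_inner_of_square_integrable:
  assumes X: "square_integrable M X" and Y: "square_integrable M Y"
  shows "integrable M (\<lambda>\<omega>. X \<omega> \<bullet> Y \<omega>)"
proof -
  have *: "x \<bullet> y = ((norm (x + y))\<^sup>2 - (norm x)\<^sup>2 - (norm y)\<^sup>2) / 2" for x y :: 'b
    by (rule dot_norm)
  show ?thesis
    unfolding * using square_integrable_add[OF X Y] X Y by (simp add: square_integrable_def)
qed

lemma (in finite_measure) square_integrable_const: "square_integrable M (\<lambda>_. c)"
  by (simp add: square_integrable_def)

lemma (in finite_measure) integrable_of_square_integrable:
  fixes X :: "'a \<Rightarrow> real"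
  assumes "square_integrable M X"
  shows "integrable M X"
  using integrable_inner_of_square_integrable[OF assms square_integrable_const[of 1]] by simp

text \<open>A Lipschitz map grows at most linearly, and constants are square integrable on a finite
  measure space.\<close>

lemma (in finite_measure) square_integrable_lipschitz:
  fixes h :: "'b::euclidean_space \<Rightarrow> 'c::euclidean_space"
  assumes X: "square_integrable M X"
    and lip: "\<And>u u'. norm (h u - h u') \<le> L * norm (u - u')"
    and h: "h \<in> borel_measurable borel"
  shows "square_integrable M (\<lambda>\<omega>. h (X \<omega>))"
proof (rule square_integrable_bound)
  have "square_integrable M (\<lambda>\<omega>. norm (X \<omega>))"
    using X by (auto simp: square_integrable_def)
  from square_integrable_add[OF square_integrable_const square_integrable_scaleR[OF this]]
  show "square_integrable M (\<lambda>\<omega>. norm (h 0) + L *\<^sub>R norm (X \<omega>))" .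
  show "norm (h (X \<omega>)) \<le> norm (norm (h 0) + L *\<^sub>R norm (X \<omega>))" for \<omega>
    using lip[of "X \<omega>" 0] norm_triangle_sub[of "h (X \<omega>)" "h 0"] by simp
  show "(\<lambda>\<omega>. h (X \<omega>)) \<in> borel_measurable M"
    using X h by (auto simp: square_integrable_def intro: measurable_compose)
qed

lemma square_integrable_nth:
  fixes X :: "'w \<Rightarrow> real ^ 'n"
  assumes "square_integrable M X"
  shows "square_integrable M (\<lambda>\<omega>. X \<omega> $ i)"
proof (rule square_integrable_bound[OF assms])
  have "(\<lambda>\<omega>. X \<omega> \<bullet> axis i 1) \<in> borel_measurable M"
    using square_integrable_measurable[OF assms] by simp
  then show "(\<lambda>\<omega>. X \<omega> $ i) \<in> borel_measurable M" by (simp add: inner_axis)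
  show "norm (X \<omega> $ i) \<le> norm (X \<omega>)" for \<omega>
    by (simp add: component_le_norm_cart)
qed

text \<open>Pythagoras in L^2, the source of the division by the batch size. For infinite
  \<open>I\<close> both sums default to 0.\<close>

lemma integral_norm_square_sum_orthogonal:
  assumes "\<And>i. i \<in> I \<Longrightarrow> square_integrable M (X i)"
    and "\<And>i j. i \<in> I \<Longrightarrow> j \<in> I \<Longrightarrow> i \<noteq> j \<Longrightarrow> (\<integral>\<omega>. X i \<omega> \<bullet> X j \<omega> \<partial>M) = 0"
  shows "(\<integral>\<omega>. (norm (\<Sum>i\<in>I. X i \<omega>))\<^sup>2 \<partial>M) = (\<Sum>i\<in>I. \<integral>\<omega>. (norm (X i \<omega>))\<^sup>2 \<partial>M)"
  using assms
proof (induction I rule: infinite_finite_induct)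
  case (insert i I)
  let ?S = "\<lambda>\<omega>. \<Sum>j\<in>I. X j \<omega>"
  have S: "square_integrable M ?S" and Xi: "square_integrable M (X i)"
    using insert.prems by (auto intro: square_integrable_sum)
  have "(\<integral>\<omega>. X i \<omega> \<bullet> ?S \<omega> \<partial>M) = (\<Sum>j\<in>I. \<integral>\<omega>. X i \<omega> \<bullet> X j \<omega> \<partial>M)"
    unfolding inner_sum_right using insert.prems
    by (intro Bochner_Integration.integral_sum integrable_inner_of_square_integrable) auto
  also have "\<dots> = 0" using insert.prems insert.hyps by (intro sum.neutral ballI) auto
  finally have cross: "(\<integral>\<omega>. X i \<omega> \<bullet> ?S \<omega> \<partial>M) = 0" .
  have "(\<integral>\<omega>. (norm (\<Sum>j\<in>insert i I. X j \<omega>))\<^sup>2 \<partial>M)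
      = (\<integral>\<omega>. (norm (X i \<omega>))\<^sup>2 + 2 * (X i \<omega> \<bullet> ?S \<omega>) + (norm (?S \<omega>))\<^sup>2 \<partial>M)"
    using insert.hyps
    by (intro Bochner_Integration.integral_cong)
       (auto simp: power2_norm_eq_inner algebra_simps inner_commute)
  also have "\<dots> = (\<integral>\<omega>. (norm (X i \<omega>))\<^sup>2 \<partial>M) + (\<integral>\<omega>. (norm (?S \<omega>))\<^sup>2 \<partial>M)"
    using cross square_integrable_norm_square[OF S] square_integrable_norm_square[OF Xi]
      integrable_inner_of_square_integrable[OF Xi S]
    by simp
  finally show ?case using insert by simp
qed auto

subsection \<open>Centred and uncorrelated noise\<close>

text \<open>The measurable factor is pulled out of the conditional expectation. Integrability is
  asked of the product alone, because the factor produced by Fubini below comes without moments of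
  its own.\<close>

lemma (in sigma_finite_subalgebra) integral_mult_eq_0_of_real_cond_exp_eq_0:
  assumes "AE \<omega> in M. real_cond_exp M F X \<omega> = 0" "h \<in> borel_measurable F" "X \<in> borel_measurable M"
    and "integrable M (\<lambda>\<omega>. h \<omega> * X \<omega>)"
  shows "(\<integral>\<omega>. h \<omega> * X \<omega> \<partial>M) = 0"
proof -
  have "(\<integral>\<omega>. h \<omega> * X \<omega> \<partial>M) = (\<integral>\<omega>. h \<omega> * real_cond_exp M F X \<omega> \<partial>M)"
    using real_cond_exp_intg(2)[OF assms(4,2,3)] by simp
  also have "\<dots> = 0"
    using assms(1) by (intro integral_eq_zero_AE) auto
  finally show ?thesis .
qed

lemma (in sigma_finite_subalgebra) real_cond_exp_centered:
  assumes "AE \<omega> in M. real_cond_exp M F X \<omega> = Y \<omega>" "Y \<in> borel_measurable F"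
    and "integrable M X" "integrable M Y"
  shows "AE \<omega> in M. real_cond_exp M F (\<lambda>\<omega>. X \<omega> - Y \<omega>) \<omega> = 0"
  using assms(1) real_cond_exp_diff[OF assms(3,4)] real_cond_exp_F_meas[OF assms(4,2)]
  by eventually_elim simp

text \<open>Image measures commute with products. Independence of the images is recorded as a
  product law, since \<open>indep_var\<close> relates two variables of one type, whereas here a pair
  of iterate and sample meets a single sample.\<close>

lemma (in prob_space) distr_pair_of_indep_var:
  assumes indep: "indep_var NA A NB B" and f: "f \<in> NA \<rightarrow>\<^sub>M S" and g: "g \<in> NB \<rightarrow>\<^sub>M T"
  shows "distr M S (\<lambda>\<omega>. f (A \<omega>)) \<Otimes>\<^sub>M distr M T (\<lambda>\<omega>. g (B \<omega>))
    = distr M (S \<Otimes>\<^sub>M T) (\<lambda>\<omega>. (f (A \<omega>), g (B \<omega>)))"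
proof -
  have [measurable]: "A \<in> M \<rightarrow>\<^sub>M NA" "B \<in> M \<rightarrow>\<^sub>M NB"
    using indep_var_rv1[OF indep] indep_var_rv2[OF indep] by auto
  note [measurable] = f g
  interpret PB: prob_space "distr M T (\<lambda>\<omega>. g (B \<omega>))" by (rule prob_space_distr) simp
  have fA: "distr M S (\<lambda>\<omega>. f (A \<omega>)) = distr (distr M NA A) S f"
    and gB: "distr M T (\<lambda>\<omega>. g (B \<omega>)) = distr (distr M NB B) T g"
    by (simp_all add: distr_distr comp_def)
  have "distr M S (\<lambda>\<omega>. f (A \<omega>)) \<Otimes>\<^sub>M distr M T (\<lambda>\<omega>. g (B \<omega>))
      = distr (distr M NA A \<Otimes>\<^sub>M distr M NB B) (S \<Otimes>\<^sub>M T) (\<lambda>(x, y). (f x, g y))"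
    using PB.sigma_finite_measure_axioms unfolding fA gB
    by (intro pair_measure_distr) auto
  also have "distr M NA A \<Otimes>\<^sub>M distr M NB B = distr M (NA \<Otimes>\<^sub>M NB) (\<lambda>\<omega>. (A \<omega>, B \<omega>))"
    using indep by (simp add: indep_var_distribution_eq)
  also have "distr \<dots> (S \<Otimes>\<^sub>M T) (\<lambda>(x, y). (f x, g y)) = distr M (S \<Otimes>\<^sub>M T) (\<lambda>\<omega>. (f (A \<omega>), g (B \<omega>)))"
    by (simp add: distr_distr comp_def)
  finally show ?thesis .
qed

text \<open>Fubini turns the cross moment into the expectation of \<open>a (U, S) * A U\<close>, where \<open>A u\<close>
  integrates \<open>a (u, S')\<close>; since \<open>A U\<close> is measurable for the conditioning algebra, centring of
  \<open>a (U, S)\<close> alone suffices.\<close>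

lemma (in prob_space) integral_mult_eq_0_of_indep_sample:
  fixes a :: "'b \<times> 'c \<Rightarrow> real"
  assumes sub: "subalgebra M H" and U: "U \<in> H \<rightarrow>\<^sub>M NU"
    and a: "a \<in> borel_measurable (NU \<Otimes>\<^sub>M NS)"
    and S [measurable]: "S \<in> M \<rightarrow>\<^sub>M NS" and S' [measurable]: "S' \<in> M \<rightarrow>\<^sub>M NS"
    and indep: "distr M (NU \<Otimes>\<^sub>M NS) (\<lambda>\<omega>. (U \<omega>, S \<omega>)) \<Otimes>\<^sub>M distr M NS S'
      = distr M ((NU \<Otimes>\<^sub>M NS) \<Otimes>\<^sub>M NS) (\<lambda>\<omega>. ((U \<omega>, S \<omega>), S' \<omega>))"
    and si: "square_integrable M (\<lambda>\<omega>. a (U \<omega>, S \<omega>))" "square_integrable M (\<lambda>\<omega>. a (U \<omega>, S' \<omega>))"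
    and centered: "AE \<omega> in M. real_cond_exp M H (\<lambda>\<omega>. a (U \<omega>, S \<omega>)) \<omega> = 0"
  shows "(\<integral>\<omega>. a (U \<omega>, S \<omega>) * a (U \<omega>, S' \<omega>) \<partial>M) = 0"
proof -
  interpret fin: finite_measure_subalgebra M H by standard (rule sub)
  note [measurable] = a
  have [measurable]: "U \<in> M \<rightarrow>\<^sub>M NU" using measurable_from_subalg[OF sub U] .
  define Q where "Q = distr M (NU \<Otimes>\<^sub>M NS) (\<lambda>\<omega>. (U \<omega>, S \<omega>))"
  define P where "P = distr M NS S'"
  interpret Q: prob_space Q unfolding Q_def by (rule prob_space_distr) simp
  interpret P: prob_space P unfolding P_def by (rule prob_space_distr) simp
  interpret QP: pair_prob_space Q P ..
  have joint: "Q \<Otimes>\<^sub>M P = distr M ((NU \<Otimes>\<^sub>M NS) \<Otimes>\<^sub>M NS) (\<lambda>\<omega>. ((U \<omega>, S \<omega>), S' \<omega>))"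
    using indep unfolding Q_def P_def .
  define b where "b = (\<lambda>p. a (fst p) * a (fst (fst p), snd p))"
  have [measurable]: "b \<in> borel_measurable ((NU \<Otimes>\<^sub>M NS) \<Otimes>\<^sub>M NS)"
    unfolding b_def by measurable
  have "integrable M (\<lambda>\<omega>. b ((U \<omega>, S \<omega>), S' \<omega>))"
    using integrable_inner_of_square_integrable[OF si] by (simp add: b_def)
  then have int_b: "integrable (Q \<Otimes>\<^sub>M P) b"
    unfolding joint by (subst integrable_distr_eq) auto
  define A where "A u = (\<integral>s. a (u, s) \<partial>P)" for u
  have A: "A \<in> borel_measurable NU"
  proof -
    have "sets (NU \<Otimes>\<^sub>M P) = sets (NU \<Otimes>\<^sub>M NS)"
      by (rule sets_pair_measure_cong) (auto simp: P_def)
    then have "a \<in> borel_measurable (NU \<Otimes>\<^sub>M P)" using a by (simp cong: measurable_cong_sets)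
    then show ?thesis unfolding A_def by (intro P.borel_measurable_lebesgue_integral) simp
  qed
  have inner: "(\<integral>s. b (p, s) \<partial>P) = A (fst p) * a p" for p
    by (simp add: b_def A_def mult.commute)
  have [measurable]: "(\<lambda>p. A (fst p) * a p) \<in> borel_measurable (NU \<Otimes>\<^sub>M NS)"
    using A by measurable
  \<comment> \<open>Fubini yields this integrability as well, so no estimate of \<open>A\<close> is
    required.\<close>
  have "integrable Q (\<lambda>p. A (fst p) * a p)"
    using QP.integrable_fst'[OF int_b] by (simp add: inner)
  then have int: "integrable M (\<lambda>\<omega>. A (U \<omega>) * a (U \<omega>, S \<omega>))"
    unfolding Q_def by (subst (asm) integrable_distr_eq) auto
  have "(\<integral>\<omega>. a (U \<omega>, S \<omega>) * a (U \<omega>, S' \<omega>) \<partial>M) = (\<integral>\<omega>. b ((U \<omega>, S \<omega>), S' \<omega>) \<partial>M)"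
    by (simp add: b_def)
  also have "\<dots> = (\<integral>p. b p \<partial>(Q \<Otimes>\<^sub>M P))"
    unfolding joint by (rule integral_distr[symmetric]) auto
  also have "\<dots> = (\<integral>p. A (fst p) * a p \<partial>Q)"
    using QP.integral_fst'[OF int_b] by (simp add: inner)
  also have "\<dots> = (\<integral>\<omega>. A (U \<omega>) * a (U \<omega>, S \<omega>) \<partial>M)"
    unfolding Q_def by (subst integral_distr) auto
  also have "\<dots> = 0"
    using int U A
    by (intro fin.integral_mult_eq_0_of_real_cond_exp_eq_0[OF centered]) (auto intro: measurable_compose)
  finally show ?thesis .
qed

lemma (in prob_space) integral_inner_eq_0_of_indep_sample:
  fixes a :: "'b \<times> 'c \<Rightarrow> real ^ 'n"
  assumes sub: "subalgebra M H" and U: "U \<in> H \<rightarrow>\<^sub>M NU"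
    and a: "a \<in> borel_measurable (NU \<Otimes>\<^sub>M NS)"
    and S: "S \<in> M \<rightarrow>\<^sub>M NS" "S' \<in> M \<rightarrow>\<^sub>M NS"
    and indep: "distr M (NU \<Otimes>\<^sub>M NS) (\<lambda>\<omega>. (U \<omega>, S \<omega>)) \<Otimes>\<^sub>M distr M NS S'
      = distr M ((NU \<Otimes>\<^sub>M NS) \<Otimes>\<^sub>M NS) (\<lambda>\<omega>. ((U \<omega>, S \<omega>), S' \<omega>))"
    and si: "square_integrable M (\<lambda>\<omega>. a (U \<omega>, S \<omega>))" "square_integrable M (\<lambda>\<omega>. a (U \<omega>, S' \<omega>))"
    and centered: "\<And>i. AE \<omega> in M. real_cond_exp M H (\<lambda>\<omega>. a (U \<omega>, S \<omega>) $ i) \<omega> = 0"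
  shows "(\<integral>\<omega>. a (U \<omega>, S \<omega>) \<bullet> a (U \<omega>, S' \<omega>) \<partial>M) = 0"
proof -
  have ai: "(\<lambda>p. a p $ i) \<in> borel_measurable (NU \<Otimes>\<^sub>M NS)" for i
    using borel_measurable_inner[OF a borel_measurable_const[of "axis i 1"]] by (simp add: inner_axis)
  have zero: "(\<integral>\<omega>. a (U \<omega>, S \<omega>) $ i * a (U \<omega>, S' \<omega>) $ i \<partial>M) = 0" for i
    by (rule integral_mult_eq_0_of_indep_sample[where a = "\<lambda>p. a p $ i",
          OF sub U ai S indep square_integrable_nth[OF si(1)] square_integrable_nth[OF si(2)] centered])
  have "(\<integral>\<omega>. a (U \<omega>, S \<omega>) \<bullet> a (U \<omega>, S' \<omega>) \<partial>M)
      = (\<Sum>i\<in>UNIV. \<integral>\<omega>. a (U \<omega>, S \<omega>) $ i * a (U \<omega>, S' \<omega>) $ i \<partial>M)"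
    unfolding inner_vec_def inner_real_def
    using integrable_inner_of_square_integrable[OF square_integrable_nth[OF si(1)] square_integrable_nth[OF si(2)]]
    by (intro Bochner_Integration.integral_sum) simp
  then show ?thesis by (simp add: zero)
qed

lemma (in sigma_finite_subalgebra) integral_inner_eq_0_of_real_cond_exp_eq_0:
  fixes X h :: "'a \<Rightarrow> real ^ 'n"
  assumes X: "square_integrable M X" "\<And>i. AE \<omega> in M. real_cond_exp M F (\<lambda>\<omega>. X \<omega> $ i) \<omega> = 0"
    and h: "square_integrable M h" "h \<in> borel_measurable F"
  shows "(\<integral>\<omega>. h \<omega> \<bullet> X \<omega> \<partial>M) = 0"
proof -
  have int: "integrable M (\<lambda>\<omega>. h \<omega> $ i * X \<omega> $ i)" for i
    using integrable_inner_of_square_integrable[OF square_integrable_nth[OF h(1)] square_integrable_nth[OF X(1)]]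
    by simp
  have hi: "(\<lambda>\<omega>. h \<omega> $ i) \<in> borel_measurable F" for i
    using borel_measurable_inner[OF h(2) borel_measurable_const[of "axis i 1"]] by (simp add: inner_axis)
  have "(\<integral>\<omega>. h \<omega> $ i * X \<omega> $ i \<partial>M) = 0" for i
    by (rule integral_mult_eq_0_of_real_cond_exp_eq_0[OF X(2) hi _ int])
       (rule square_integrable_measurable[OF square_integrable_nth[OF X(1)]])
  then show ?thesis
    unfolding inner_vec_def inner_real_def using int by simp
qed

section \<open>The history and conditional second moments\<close>

lemma subalgebra_history:
  assumes X0: "X0 \<in> borel_measurable M"
    and \<xi>: "\<And>j t. 1 \<le> j \<Longrightarrow> j \<le> N t \<Longrightarrow> \<xi> j t \<in> borel_measurable M"
  shows "subalgebra M (history M X0 \<xi> N k)"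
proof -
  let ?G = "{X0 -` A \<inter> space M | A. A \<in> sets borel} \<union>
      (\<Union>t<k. \<Union>j\<in>{1..N t}. {\<xi> j t -` A \<inter> space M | A. A \<in> sets borel})"
  have "?G \<subseteq> sets M"
    using X0 \<xi> by (auto intro: measurable_sets)
  then have "sigma_sets (space M) ?G \<subseteq> sets M"
    by (rule sets.sigma_sets_subset)
  moreover have "?G \<subseteq> Pow (space M)" by auto
  ultimately show ?thesis
    by (simp add: subalgebra_def history_def space_measure_of sets_measure_of)
qed

lemma space_history: "space (history M X0 \<xi> N k) = space M"
  by (simp add: history_def space_measure_of_conv)

lemma borel_measurable_sample_history:
  fixes \<xi> :: "nat \<Rightarrow> nat \<Rightarrow> 'w \<Rightarrow> real ^ 'd"
  assumes "t < k" "1 \<le> j" "j \<le> N t"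
  shows "\<xi> j t \<in> borel_measurable (history M X0 \<xi> N k)"
proof (rule measurableI)
  fix A :: "(real ^ 'd) set"
  assume A: "A \<in> sets borel"
  let ?G = "{X0 -` A \<inter> space M | A. A \<in> sets borel} \<union>
      (\<Union>t<k. \<Union>j\<in>{1..N t}. {\<xi> j t -` A \<inter> space M | A. A \<in> sets borel})"
  have G: "?G \<subseteq> Pow (space M)" by auto
  have "\<xi> j t -` A \<inter> space M \<in> ?G" using A assms by auto
  then have "\<xi> j t -` A \<inter> space M \<in> sigma_sets (space M) ?G" by (rule sigma_sets.Basic)
  then show "\<xi> j t -` A \<inter> space (history M X0 \<xi> N k) \<in> sets (history M X0 \<xi> N k)"
    unfolding space_history using G by (simp add: history_def sets_measure_of)
qed simp

text \<open>Testing the conditional bound against the constant 1 removes the conditioning.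
  Nonnegative integrals allow this before integrability is known; finiteness then provides
  it.\<close>

lemma (in prob_space) square_integrable_of_nn_cond_exp_bound:
  assumes sub: "subalgebra M H" and X: "X \<in> borel_measurable M"
    and bound: "AE \<omega> in M. nn_cond_exp M H (\<lambda>\<omega>. ennreal ((norm (X \<omega>))\<^sup>2)) \<omega> \<le> ennreal (\<nu>\<^sup>2)"
  shows "square_integrable M X" and "(\<integral>\<omega>. (norm (X \<omega>))\<^sup>2 \<partial>M) \<le> \<nu>\<^sup>2"
proof -
  interpret fin: finite_measure_subalgebra M H by standard (rule sub)
  have "(\<integral>\<^sup>+\<omega>. ennreal ((norm (X \<omega>))\<^sup>2) \<partial>M)
      = (\<integral>\<^sup>+\<omega>. nn_cond_exp M H (\<lambda>\<omega>. ennreal ((norm (X \<omega>))\<^sup>2)) \<omega> \<partial>M)"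
    using fin.nn_cond_exp_intg[of "\<lambda>_. 1" "\<lambda>\<omega>. ennreal ((norm (X \<omega>))\<^sup>2)"] X by simp
  also have "\<dots> \<le> (\<integral>\<^sup>+\<omega>. ennreal (\<nu>\<^sup>2) \<partial>M)"
    using bound by (rule nn_integral_mono_AE)
  also have "\<dots> = ennreal (\<nu>\<^sup>2)" by (simp add: emeasure_space_1)
  finally have le: "(\<integral>\<^sup>+\<omega>. ennreal ((norm (X \<omega>))\<^sup>2) \<partial>M) \<le> ennreal (\<nu>\<^sup>2)" .
  then have "(\<integral>\<^sup>+\<omega>. ennreal ((norm (X \<omega>))\<^sup>2) \<partial>M) < \<infinity>"
    by (rule le_less_trans) simp
  then have int: "integrable M (\<lambda>\<omega>. (norm (X \<omega>))\<^sup>2)"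
    using X by (intro integrableI_nonneg) auto
  then show "square_integrable M X" using X by (simp add: square_integrable_def)
  show "(\<integral>\<omega>. (norm (X \<omega>))\<^sup>2 \<partial>M) \<le> \<nu>\<^sup>2"
    using le by (subst (asm) nn_integral_eq_integral[OF int]) auto
qed

subsection \<open>Convergence rate\<close>

text \<open>Integrability is asserted with the bound because the Bochner integral of a
  non-integrable function is 0 by default, and the inequality alone would then not concern an
  expectation.\<close>

theorem proposition6:
  fixes M :: "'w measure"
    and F :: "real ^ 'm \<Rightarrow> real ^ 'd \<Rightarrow> real"
    and \<xi>\<^sub>0 :: "'w \<Rightarrow> real ^ 'd"
    and \<xi> :: "nat \<Rightarrow> nat \<Rightarrow> 'w \<Rightarrow> real ^ 'd"
    and f :: "real ^ 'm \<Rightarrow> real"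
    and x y w :: "nat \<Rightarrow> 'w \<Rightarrow> real ^ 'm"
    and x0 :: "real ^ 'm"
    and N :: "nat \<Rightarrow> nat"
    and L \<eta> \<nu> \<alpha> \<beta> \<gamma> v :: real
  assumes prob: "prob_space M"
    and xi0_meas: "\<xi>\<^sub>0 \<in> borel_measurable M"
    and F_meas: "(\<lambda>(u, z). F u z) \<in> borel_measurable (borel \<Otimes>\<^sub>M borel)"
    and F_diff: "\<And>u z. (\<lambda>u'. F u' z) differentiable (at u)"
    and F_int: "\<And>u. integrable M (\<lambda>\<omega>. F u (\<xi>\<^sub>0 \<omega>))"
    and f_eq: "\<And>u. f u = (\<integral>\<omega>. F u (\<xi>\<^sub>0 \<omega>) \<partial>M)"
    and L_pos: "L > 0" and eta_pos: "\<eta> > 0" and nu_pos: "\<nu> > 0" and v_pos: "v > 0"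
    and alpha: "0 < \<alpha>" "\<alpha> \<le> 1 / L"
    and gamma: "\<gamma> = sqrt (\<alpha> * \<eta>)"
    and beta: "\<beta> = (1 - \<gamma>) / (1 + \<gamma>)"
    and N_eq: "\<And>k. N k = nat \<lceil>(real k + 1) powr v\<rceil>"
    and xi_indep: "prob_space.indep_vars M (\<lambda>_. borel) (\<lambda>(j, k). \<xi> j k)
                     {(j, k). 1 \<le> j \<and> j \<le> N k}"
    and xi_distr: "\<And>j k. 1 \<le> j \<Longrightarrow> j \<le> N k \<Longrightarrow> distr M borel (\<xi> j k) = distr M borel \<xi>\<^sub>0"
    and init: "\<And>\<omega>. \<omega> \<in> space M \<Longrightarrow> x 0 \<omega> = x0" "\<And>\<omega>. \<omega> \<in> space M \<Longrightarrow> y 0 \<omega> = x0"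
    and w_eq: "\<And>k \<omega>. \<omega> \<in> space M \<Longrightarrow>
        w k \<omega> = (1 / real (N k)) *\<^sub>R (\<Sum>j=1..N k. gradient (\<lambda>u. F u (\<xi> j k \<omega>)) (x k \<omega>))
                 - gradient f (x k \<omega>)"
    and y_step: "\<And>k \<omega>. \<omega> \<in> space M \<Longrightarrow>
        y (Suc k) \<omega> = x k \<omega> - \<alpha> *\<^sub>R (gradient f (x k \<omega>) + w k \<omega>)"
    and x_step: "\<And>k \<omega>. \<omega> \<in> space M \<Longrightarrow>
        x (Suc k) \<omega> = y (Suc k) \<omega> + \<beta> *\<^sub>R (y (Suc k) \<omega> - y k \<omega>)"
    and f_diff: "f differentiable_on UNIV"
    and f_C1: "continuous_on UNIV (gradient f)"
    and f_smooth: "\<And>u u'. norm (gradient f u - gradient f u') \<le> L * norm (u - u')"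
    and f_convex: "\<And>u u'. (gradient f u - gradient f u') \<bullet> (u - u') \<ge> \<eta> * (norm (u - u'))\<^sup>2"
    and unbiased: "\<And>j k. 1 \<le> j \<Longrightarrow> j \<le> N k \<Longrightarrow>
        AE \<omega> in M. vec_cond_exp M (history M (x 0) \<xi> N k)
                      (\<lambda>\<omega>'. gradient (\<lambda>u. F u (\<xi> j k \<omega>')) (x k \<omega>')) \<omega> = gradient f (x k \<omega>)"
    and noise: "\<And>j k. 1 \<le> j \<Longrightarrow> j \<le> N k \<Longrightarrow>
        AE \<omega> in M. nn_cond_exp M (history M (x 0) \<xi> N k)
                      (\<lambda>\<omega>'. ennreal ((norm (gradient (\<lambda>u. F u (\<xi> j k \<omega>')) (x k \<omega>')
                                               - gradient f (x k \<omega>')))\<^sup>2)) \<omega> \<le> ennreal (\<nu>\<^sup>2)"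
  shows "\<exists>C>0. \<forall>k\<ge>1. integrable M (\<lambda>\<omega>. f (y k \<omega>)) \<and>
           (\<integral>\<omega>. f (y k \<omega>) \<partial>M) - f (arg_min f (\<lambda>_. True)) \<le> C * real k powr (- v)"
proof -

  \<comment> \<open>Constants and the minimizer\<close>
  interpret prob_space M by (rule prob)
  have f_diff': "f differentiable (at u)" for u
    using f_diff by (simp add: differentiable_on_def)
  note upper = lipschitz_gradient_upper[OF f_diff' f_smooth]
  note lower = strongly_monotone_gradient_lower[OF f_diff' f_convex]
  define z where "z = arg_min f (\<lambda>_. True)"
  have f_cont: "continuous_on UNIV f"
    using f_diff by (rule differentiable_imp_continuous_on)
  have z: "f z \<le> f u" for u
    unfolding z_def using lower[of 0] eta_pos
    by (intro arg_min_le_of_quadratic_growth[OF f_cont, where \<eta> = \<eta> and p = "gradient f 0"]) auto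
  have alpha_L: "\<alpha> * L \<le> 1" using alpha L_pos by (simp add: field_simps)
  \<comment> \<open>Testing strong monotonicity and the Lipschitz bound on a unit vector, which
    exists because the index type is nonempty, gives \<open>\<eta> \<le> L\<close>; hence
    \<open>\<alpha> * \<eta> \<le> \<alpha> * L \<le> 1\<close>.\<close>
  have \<gamma>: "\<gamma>\<^sup>2 = \<alpha> * \<eta>" "0 < \<gamma>" "\<gamma> \<le> 1"
  proof -
    have "\<eta> * (norm (axis undefined 1 :: real ^ 'm))\<^sup>2 \<le> L * (norm (axis undefined 1 :: real ^ 'm))\<^sup>2"
    proof -
      let ?e = "axis undefined 1 :: real ^ 'm"
      have "\<eta> * (norm (?e - 0))\<^sup>2 \<le> (gradient f ?e - gradient f 0) \<bullet> (?e - 0)" by (rule f_convex)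
      also have "\<dots> \<le> norm (gradient f ?e - gradient f 0) * norm (?e - 0)" by (rule norm_cauchy_schwarz)
      also have "\<dots> \<le> (L * norm (?e - 0)) * norm (?e - 0)" by (intro mult_right_mono f_smooth) simp
      finally show ?thesis by (simp add: power2_eq_square)
    qed
    then have "\<eta> \<le> L" by simp
    then have "\<alpha> * \<eta> \<le> 1" using alpha_L alpha mult_left_mono[of \<eta> L \<alpha>] by linarith
    then show "\<gamma>\<^sup>2 = \<alpha> * \<eta>" "0 < \<gamma>" "\<gamma> \<le> 1" using alpha eta_pos by (auto simp: gamma)
  qed
  have N_ge: "real (N k) \<ge> (real k + 1) powr v" for k
    unfolding N_eq by linarith
  have N_pos: "N k > 0" for k
    using N_ge[of k] powr_gt_zero[of "real k + 1" v] by (cases "N k") auto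

  \<comment> \<open>Sampled gradients and the iterates as functions of the samples\<close>
  define G where "G = (\<lambda>(u, z). gradient (\<lambda>u. F u z) u)"
  have G [measurable]: "G \<in> borel_measurable (borel \<Otimes>\<^sub>M borel)"
    unfolding G_def by (rule borel_measurable_gradient[OF F_meas F_diff])
  have g [measurable]: "gradient f \<in> borel_measurable borel"
    by (rule borel_measurable_continuous_onI[OF f_C1])
  \<comment> \<open>The noise as a deterministic function of point and sample, so that Fubini can
    integrate over one sample with the point fixed.\<close>
  define a where "a = (\<lambda>p. G p - gradient f (fst p))"
  have a [measurable]: "a \<in> borel_measurable (borel \<Otimes>\<^sub>M borel)"
    unfolding a_def by measurable
  have w_a: "w k \<omega> = (1 / real (N k)) *\<^sub>R (\<Sum>j=1..N k. a (x k \<omega>, \<xi> j k \<omega>))" if "\<omega> \<in> space M" for k \<omega>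
    using N_pos[of k]
    by (simp add: w_eq[OF that] a_def G_def sum_subtractf scaleR_diff_right sum_constant_scaleR del: sum_constant)
  \<comment> \<open>The exact gradient cancels against the one inside \<open>w k\<close>.\<close>
  have y_G: "y (Suc k) \<omega> = x k \<omega> - (\<alpha> / real (N k)) *\<^sub>R (\<Sum>j=1..N k. G (x k \<omega>, \<xi> j k \<omega>))"
    if "\<omega> \<in> space M" for k \<omega>
    using w_eq[OF that] by (simp add: y_step[OF that] G_def)

  define J where "J = (\<lambda>k. {(j, t). t < k \<and> 1 \<le> j \<and> j \<le> N t})"
  define Xi where "Xi = (\<lambda>(j, k). \<xi> j k)"
  have \<xi>_meas [measurable]: "\<xi> j k \<in> borel_measurable M" if "1 \<le> j" "j \<le> N k" for j k
    using xi_indep that by (auto simp: indep_vars_def2)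
  \<comment> \<open>Unlike measurability for the history, a representation by a function of the samples can be combined
    with block independence.\<close>
  have rep: "\<exists>\<Phi> \<Psi>. \<Phi> \<in> borel_measurable (PiM (J k) (\<lambda>_. borel)) \<and> \<Psi> \<in> borel_measurable (PiM (J k) (\<lambda>_. borel)) \<and>
      (\<forall>\<omega>\<in>space M. x k \<omega> = \<Phi> (\<lambda>i\<in>J k. Xi i \<omega>) \<and> y k \<omega> = \<Psi> (\<lambda>i\<in>J k. Xi i \<omega>))" for k
  proof (induction k)
    case 0
    \<comment> \<open>\<open>J 0\<close> is empty and the start deterministic, so constants
      represent both iterates.\<close>
    show ?case using init by (intro exI[of _ "\<lambda>_. x0"]) auto
  next
    case (Suc k)
    then obtain \<Phi> \<Psi> where \<Phi>: "\<Phi> \<in> borel_measurable (PiM (J k) (\<lambda>_. borel))"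
      and \<Psi>: "\<Psi> \<in> borel_measurable (PiM (J k) (\<lambda>_. borel))"
      and xy: "\<And>\<omega>. \<omega> \<in> space M \<Longrightarrow> x k \<omega> = \<Phi> (\<lambda>i\<in>J k. Xi i \<omega>) \<and> y k \<omega> = \<Psi> (\<lambda>i\<in>J k. Xi i \<omega>)"
      by blast
    have sub: "J k \<subseteq> J (Suc k)" by (auto simp: J_def)
    have restr: "(\<lambda>\<zeta>. restrict \<zeta> (J k)) \<in> PiM (J (Suc k)) (\<lambda>_. borel) \<rightarrow>\<^sub>M PiM (J k) (\<lambda>_. borel :: (real ^ 'd) measure)"
      by (rule measurable_restrict_subset[OF sub])
    note [measurable] = measurable_compose[OF restr \<Phi>] measurable_compose[OF restr \<Psi>]
    define \<Psi>' where "\<Psi>' = (\<lambda>\<zeta>. \<Phi> (restrict \<zeta> (J k))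
        - (\<alpha> / real (N k)) *\<^sub>R (\<Sum>j=1..N k. G (\<Phi> (restrict \<zeta> (J k)), \<zeta> (j, k))))"
    have comp: "(\<lambda>\<zeta>. \<zeta> (j, k)) \<in> PiM (J (Suc k)) (\<lambda>_. borel) \<rightarrow>\<^sub>M (borel :: (real ^ 'd) measure)"
      if "j \<in> {1..N k}" for j
      using that by (intro measurable_component_singleton) (auto simp: J_def)
    have [measurable]: "\<Psi>' \<in> borel_measurable (PiM (J (Suc k)) (\<lambda>_. borel))"
      unfolding \<Psi>'_def
      by (intro borel_measurable_diff borel_measurable_scaleR borel_measurable_const borel_measurable_sum
          measurable_compose[OF measurable_Pair G] measurable_compose[OF restr \<Phi>] comp)
    define \<Phi>' where "\<Phi>' = (\<lambda>\<zeta>. \<Psi>' \<zeta> + \<beta> *\<^sub>R (\<Psi>' \<zeta> - \<Psi> (restrict \<zeta> (J k))))"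
    have "\<Phi>' \<in> borel_measurable (PiM (J (Suc k)) (\<lambda>_. borel))"
      unfolding \<Phi>'_def by measurable
    moreover have "x (Suc k) \<omega> = \<Phi>' (\<lambda>i\<in>J (Suc k). Xi i \<omega>) \<and> y (Suc k) \<omega> = \<Psi>' (\<lambda>i\<in>J (Suc k). Xi i \<omega>)"
      if \<omega>: "\<omega> \<in> space M" for \<omega>
    proof -
      let ?Z = "\<lambda>i\<in>J (Suc k). Xi i \<omega>"
      have restr_Z: "restrict ?Z (J k) = (\<lambda>i\<in>J k. Xi i \<omega>)"
        using sub by (auto simp: fun_eq_iff)
      have "(\<Sum>j=1..N k. G (x k \<omega>, \<xi> j k \<omega>)) = (\<Sum>j=1..N k. G (x k \<omega>, ?Z (j, k)))"
        by (intro sum.cong) (auto simp: J_def Xi_def)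
      then have "y (Suc k) \<omega> = \<Psi>' ?Z"
        unfolding y_G[OF \<omega>] \<Psi>'_def restr_Z using xy[OF \<omega>] by simp
      then show ?thesis
        unfolding x_step[OF \<omega>] \<Phi>'_def restr_Z using xy[OF \<omega>] by simp
    qed
    ultimately show ?case using \<open>\<Psi>' \<in> _\<close> by blast
  qed

  \<comment> \<open>Adaptedness to the history\<close>
  define H where "H = history M (x 0) \<xi> N"
  have x0_meas: "x 0 \<in> borel_measurable M"
    using measurable_cong[of M "x 0" "\<lambda>_. x0" borel] init by simp
  have sub: "subalgebra M (H k)" for k
    unfolding H_def by (intro subalgebra_history x0_meas \<xi>_meas)
  have fin: "finite_measure_subalgebra M (H k)" for k
    by standard (rule sub)
  have space_H: "space (H k) = space M" for k
    by (simp add: H_def space_history)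
  have xy_H: "x k \<in> borel_measurable (H k)" "y k \<in> borel_measurable (H k)" for k
  proof -
    obtain \<Phi> \<Psi> where \<Phi>: "\<Phi> \<in> borel_measurable (PiM (J k) (\<lambda>_. borel))"
      and \<Psi>: "\<Psi> \<in> borel_measurable (PiM (J k) (\<lambda>_. borel))"
      and xy: "\<And>\<omega>. \<omega> \<in> space M \<Longrightarrow> x k \<omega> = \<Phi> (\<lambda>i\<in>J k. Xi i \<omega>) \<and> y k \<omega> = \<Psi> (\<lambda>i\<in>J k. Xi i \<omega>)"
      using rep[of k] by blast
    have Z: "(\<lambda>\<omega>. \<lambda>i\<in>J k. Xi i \<omega>) \<in> H k \<rightarrow>\<^sub>M PiM (J k) (\<lambda>_. borel)"
    proof (rule measurable_restrict)
      show "Xi i \<in> borel_measurable (H k)" if "i \<in> J k" for i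
        using that by (auto simp: J_def Xi_def H_def intro!: borel_measurable_sample_history)
    qed
    show "x k \<in> borel_measurable (H k)"
      using measurable_compose[OF Z \<Phi>] xy
      by (subst measurable_cong[where g = "\<lambda>\<omega>. \<Phi> (\<lambda>i\<in>J k. Xi i \<omega>)"]) (auto simp: space_H)
    show "y k \<in> borel_measurable (H k)"
      using measurable_compose[OF Z \<Psi>] xy
      by (subst measurable_cong[where g = "\<lambda>\<omega>. \<Psi> (\<lambda>i\<in>J k. Xi i \<omega>)"]) (auto simp: space_H)
  qed
  have xy_M [measurable]: "x k \<in> borel_measurable M" "y k \<in> borel_measurable M" for k
    using measurable_from_subalg[OF sub] xy_H by blast+

  \<comment> \<open>Independence within a batch\<close>
  have indep: "distr M (borel \<Otimes>\<^sub>M borel) (\<lambda>\<omega>. (x k \<omega>, \<xi> j k \<omega>)) \<Otimes>\<^sub>M distr M borel (\<xi> l k)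
      = distr M ((borel \<Otimes>\<^sub>M borel) \<Otimes>\<^sub>M borel) (\<lambda>\<omega>. ((x k \<omega>, \<xi> j k \<omega>), \<xi> l k \<omega>))"
    if jl: "j \<in> {1..N k}" "l \<in> {1..N k}" "j \<noteq> l" for j l k
  proof -
    obtain \<Phi> where \<Phi>: "\<Phi> \<in> borel_measurable (PiM (J k) (\<lambda>_. borel))"
      and x: "\<And>\<omega>. \<omega> \<in> space M \<Longrightarrow> x k \<omega> = \<Phi> (\<lambda>i\<in>J k. Xi i \<omega>)"
      using rep[of k] by blast
    \<comment> \<open>\<open>?A\<close> determines the iterate and the sample \<open>j\<close>,
      \<open>?B\<close> holds the sample \<open>l\<close>. They are disjoint since
      \<open>J k\<close> contains only iterations before \<open>k\<close> and \<open>j\<close>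
      differs from \<open>l\<close>.\<close>
    let ?A = "insert (j, k) (J k)" and ?B = "{(l, k)}"
    let ?f = "\<lambda>\<zeta>. (\<Phi> (restrict \<zeta> (J k)), \<zeta> (j, k))" and ?g = "\<lambda>\<zeta>. \<zeta> (l, k)"
    have "indep_vars (\<lambda>_. borel) Xi {(j, k). 1 \<le> j \<and> j \<le> N k}"
      using xi_indep by (simp add: Xi_def)
    then have iv: "indep_var (PiM ?A (\<lambda>_. borel)) (\<lambda>\<omega>. \<lambda>i\<in>?A. Xi i \<omega>) (PiM ?B (\<lambda>_. borel)) (\<lambda>\<omega>. \<lambda>i\<in>?B. Xi i \<omega>)"
      by (rule indep_var_restrict) (use jl in \<open>auto simp: J_def\<close>)
    have "(\<lambda>\<zeta>. restrict \<zeta> (J k)) \<in> PiM ?A (\<lambda>_. borel) \<rightarrow>\<^sub>M PiM (J k) (\<lambda>_. borel :: (real ^ 'd) measure)"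
      by (rule measurable_restrict_subset) auto
    note comp = measurable_compose[OF this \<Phi>]
    have f: "?f \<in> PiM ?A (\<lambda>_. borel) \<rightarrow>\<^sub>M borel \<Otimes>\<^sub>M borel"
      by (rule measurable_Pair[OF comp measurable_component_singleton]) simp
    have g: "?g \<in> PiM ?B (\<lambda>_. borel) \<rightarrow>\<^sub>M borel"
      by (rule measurable_component_singleton) simp
    have fZ: "?f (\<lambda>i\<in>?A. Xi i \<omega>) = (x k \<omega>, \<xi> j k \<omega>)" if "\<omega> \<in> space M" for \<omega>
    proof -
      have "restrict (\<lambda>i\<in>?A. Xi i \<omega>) (J k) = (\<lambda>i\<in>J k. Xi i \<omega>)" by (auto simp: fun_eq_iff)
      then show ?thesis using x[OF that] by (simp add: Xi_def)
    qed
    have gZ: "?g (\<lambda>i\<in>?B. Xi i \<omega>) = \<xi> l k \<omega>" for \<omega> by (simp add: Xi_def)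
    have "distr M (borel \<Otimes>\<^sub>M borel) (\<lambda>\<omega>. (x k \<omega>, \<xi> j k \<omega>)) = distr M (borel \<Otimes>\<^sub>M borel) (\<lambda>\<omega>. ?f (\<lambda>i\<in>?A. Xi i \<omega>))"
      by (intro distr_cong) (auto simp only: fZ)
    moreover have "distr M borel (\<xi> l k) = distr M borel (\<lambda>\<omega>. ?g (\<lambda>i\<in>?B. Xi i \<omega>))"
      by (intro distr_cong) (auto simp only: gZ)
    moreover have "distr M ((borel \<Otimes>\<^sub>M borel) \<Otimes>\<^sub>M borel) (\<lambda>\<omega>. ((x k \<omega>, \<xi> j k \<omega>), \<xi> l k \<omega>))
        = distr M ((borel \<Otimes>\<^sub>M borel) \<Otimes>\<^sub>M borel) (\<lambda>\<omega>. (?f (\<lambda>i\<in>?A. Xi i \<omega>), ?g (\<lambda>i\<in>?B. Xi i \<omega>)))"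
      by (intro distr_cong) (auto simp only: fZ gZ)
    ultimately show ?thesis
      using distr_pair_of_indep_var[OF iv f g] by (simp only:)
  qed

  \<comment> \<open>Square integrability and centring\<close>
  have a_si: "square_integrable M (\<lambda>\<omega>. a (x k \<omega>, \<xi> j k \<omega>))"
    and a_le: "(\<integral>\<omega>. (norm (a (x k \<omega>, \<xi> j k \<omega>)))\<^sup>2 \<partial>M) \<le> \<nu>\<^sup>2" if "j \<in> {1..N k}" for j k
  proof -
    have [measurable]: "\<xi> j k \<in> borel_measurable M" using that by (intro \<xi>_meas) auto
    have "(\<lambda>\<omega>. a (x k \<omega>, \<xi> j k \<omega>)) \<in> borel_measurable M" by measurable
    moreover have "AE \<omega> in M. nn_cond_exp M (H k) (\<lambda>\<omega>. ennreal ((norm (a (x k \<omega>, \<xi> j k \<omega>)))\<^sup>2)) \<omega> \<le> ennreal (\<nu>\<^sup>2)"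
      using noise[of j k] that by (simp add: a_def G_def H_def)
    ultimately show "square_integrable M (\<lambda>\<omega>. a (x k \<omega>, \<xi> j k \<omega>))"
      "(\<integral>\<omega>. (norm (a (x k \<omega>, \<xi> j k \<omega>)))\<^sup>2 \<partial>M) \<le> \<nu>\<^sup>2"
      by (rule square_integrable_of_nn_cond_exp_bound[OF sub])+
  qed
  have w_si: "square_integrable M (w k)" for k
    by (rule square_integrable_eqI, erule w_a)
      (intro square_integrable_scaleR square_integrable_sum a_si)
  have g_si: "square_integrable M (\<lambda>\<omega>. gradient f (X \<omega>))" if "square_integrable M X" for X
    by (rule square_integrable_lipschitz[OF that f_smooth g])
  \<comment> \<open>Each update combines terms that stay in L^2: the previous iterates, the noise
    and the Lipschitz image of the iterate.\<close>
  have xy_si: "square_integrable M (x k) \<and> square_integrable M (y k)" for k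
  proof (induction k)
    case 0
    have "square_integrable M (x 0)" "square_integrable M (y 0)"
      by (rule square_integrable_eqI, erule init, rule square_integrable_const)+
    then show ?case ..
  next
    case (Suc k)
    have "square_integrable M (y (Suc k))"
      by (rule square_integrable_eqI, erule y_step)
        (intro square_integrable_diff square_integrable_add square_integrable_scaleR w_si g_si Suc[THEN conjunct1])
    moreover from this have "square_integrable M (x (Suc k))"
      by (intro square_integrable_eqI[OF x_step] square_integrable_diff square_integrable_add
          square_integrable_scaleR Suc[THEN conjunct2])
    ultimately show ?case by (rule conjI[rotated])
  qed
  note x_si = conjunct1[OF xy_si] and y_si = conjunct2[OF xy_si]

  have centered: "AE \<omega> in M. real_cond_exp M (H k) (\<lambda>\<omega>. a (x k \<omega>, \<xi> j k \<omega>) $ i) \<omega> = 0"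
    if "j \<in> {1..N k}" for j k i
  proof -
    interpret fin: finite_measure_subalgebra M "H k" by (rule fin)
    have "AE \<omega> in M. real_cond_exp M (H k) (\<lambda>\<omega>. G (x k \<omega>, \<xi> j k \<omega>) $ i) \<omega> = gradient f (x k \<omega>) $ i"
      using unbiased[of j k] that by (auto simp: vec_cond_exp_def vec_eq_iff G_def H_def elim: eventually_mono)
    moreover have "(\<lambda>\<omega>. gradient f (x k \<omega>) $ i) \<in> borel_measurable (H k)"
      using borel_measurable_inner[OF measurable_compose[OF xy_H(1) g] borel_measurable_const[of "axis i 1"]]
      by (simp add: inner_axis)
    \<comment> \<open>The noise hypothesis controls only the centred gradient; adding
      \<open>gradient f (x k \<omega>)\<close> back recovers integrability of the sampled
      one.\<close>
    moreover have "square_integrable M (\<lambda>\<omega>. a (x k \<omega>, \<xi> j k \<omega>) + gradient f (x k \<omega>))"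
      by (intro square_integrable_add a_si[OF that] g_si x_si)
    then have "integrable M (\<lambda>\<omega>. G (x k \<omega>, \<xi> j k \<omega>) $ i)"
      by (intro integrable_of_square_integrable square_integrable_nth) (simp add: a_def)
    moreover have "integrable M (\<lambda>\<omega>. gradient f (x k \<omega>) $ i)"
      by (intro integrable_of_square_integrable square_integrable_nth g_si x_si)
    ultimately show ?thesis
      using fin.real_cond_exp_centered by (simp add: a_def)
  qed

  \<comment> \<open>Moments of the averaged noise\<close>
  have w_le: "(\<integral>\<omega>. (norm (w k \<omega>))\<^sup>2 \<partial>M) \<le> \<nu>\<^sup>2 * (real k + 1) powr (- v)" for k
  proof -
    have orth: "(\<integral>\<omega>. a (x k \<omega>, \<xi> j k \<omega>) \<bullet> a (x k \<omega>, \<xi> l k \<omega>) \<partial>M) = 0"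
      if "j \<in> {1..N k}" "l \<in> {1..N k}" "j \<noteq> l" for j l
      using that
      by (intro integral_inner_eq_0_of_indep_sample[OF sub xy_H(1) a _ _ indep] a_si centered \<xi>_meas) auto
    have "(\<integral>\<omega>. (norm (w k \<omega>))\<^sup>2 \<partial>M)
        = (\<integral>\<omega>. (1 / real (N k))\<^sup>2 * (norm (\<Sum>j=1..N k. a (x k \<omega>, \<xi> j k \<omega>)))\<^sup>2 \<partial>M)"
      by (intro Bochner_Integration.integral_cong) (auto simp: w_a power_mult_distrib power_divide)
    also have "\<dots> = (1 / real (N k))\<^sup>2 * (\<Sum>j=1..N k. \<integral>\<omega>. (norm (a (x k \<omega>, \<xi> j k \<omega>)))\<^sup>2 \<partial>M)"
      using integral_norm_square_sum_orthogonal[where X = "\<lambda>j \<omega>. a (x k \<omega>, \<xi> j k \<omega>)" and I = "{1..N k}",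
          OF a_si orth]
      by simp
    also have "\<dots> \<le> (1 / real (N k))\<^sup>2 * (\<Sum>j=1..N k. \<nu>\<^sup>2)"
      by (intro mult_left_mono sum_mono a_le) auto
    also have "\<dots> = \<nu>\<^sup>2 / real (N k)"
      using N_pos[of k] by (simp add: power2_eq_square field_simps)
    also have "\<dots> \<le> \<nu>\<^sup>2 / (real k + 1) powr v"
      using N_ge[of k] N_pos[of k] by (intro divide_left_mono mult_pos_pos) auto
    finally show ?thesis by (simp add: powr_minus divide_inverse)
  qed
  have w_orth: "(\<integral>\<omega>. h \<omega> \<bullet> w k \<omega> \<partial>M) = 0"
    if h: "square_integrable M h" "h \<in> borel_measurable (H k)" for h k
  proof -
    interpret fin: finite_measure_subalgebra M "H k" by (rule fin)
    have "(\<integral>\<omega>. h \<omega> \<bullet> a (x k \<omega>, \<xi> j k \<omega>) \<partial>M) = 0" if "j \<in> {1..N k}" for j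
      using that by (intro fin.integral_inner_eq_0_of_real_cond_exp_eq_0 a_si centered h)
    moreover have "(\<integral>\<omega>. h \<omega> \<bullet> w k \<omega> \<partial>M)
        = (\<integral>\<omega>. (1 / real (N k)) * (\<Sum>j=1..N k. h \<omega> \<bullet> a (x k \<omega>, \<xi> j k \<omega>)) \<partial>M)"
      by (intro Bochner_Integration.integral_cong) (auto simp: w_a inner_sum_right)
    moreover have "integrable M (\<lambda>\<omega>. h \<omega> \<bullet> a (x k \<omega>, \<xi> j k \<omega>))" if "j \<in> {1..N k}" for j
      by (rule integrable_inner_of_square_integrable[OF h(1) a_si[OF that]])
    ultimately show ?thesis by simp
  qed

  \<comment> \<open>The energy recursion in expectation\<close>
  define D where "D = (\<lambda>k \<omega>. x k \<omega> + (1 / \<gamma>) *\<^sub>R (x k \<omega> - y k \<omega>) - z)"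
  define V where "V = (\<lambda>k \<omega>. f (y k \<omega>) - f z + \<eta> / 2 * (norm (D k \<omega>))\<^sup>2)"
  define e where "e = (\<lambda>k \<omega>. \<alpha> *\<^sub>R gradient f (x k \<omega>) - \<gamma> *\<^sub>R (x k \<omega> - z) - (1 - \<gamma>) *\<^sub>R (x k \<omega> - y k \<omega>))"
  have V_step: "V (Suc k) \<omega> \<le> (1 - \<gamma>) * V k \<omega> + \<alpha> * (norm (w k \<omega>))\<^sup>2 + e k \<omega> \<bullet> w k \<omega>"
    if "\<omega> \<in> space M" for k \<omega>
    unfolding V_def D_def inner_commute[of "e k \<omega>"] unfolding e_def
    by (rule accelerated_step[OF upper lower alpha(1) eta_pos alpha_L \<gamma> beta y_step[OF that] x_step[OF that]])
  have f_int: "integrable M (\<lambda>\<omega>. f (y k \<omega>))" for k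
  proof (rule Bochner_Integration.integrable_bound)
    \<comment> \<open>\<open>f\<close> lies between its minimum and its quadratic majorant at
      \<open>z\<close>, so square integrability of \<open>y k\<close> is enough.\<close>
    let ?b = "\<lambda>\<omega>. \<bar>f z\<bar> + \<bar>gradient f z \<bullet> (y k \<omega> - z)\<bar> + L / 2 * (norm (y k \<omega> - z))\<^sup>2"
    have d: "square_integrable M (\<lambda>\<omega>. y k \<omega> - z)"
      by (intro square_integrable_diff y_si square_integrable_const)
    show "integrable M ?b"
      using integrable_inner_of_square_integrable[OF square_integrable_const d] square_integrable_norm_square[OF d]
      by simp
    show "(\<lambda>\<omega>. f (y k \<omega>)) \<in> borel_measurable M"
      using borel_measurable_continuous_onI[OF f_cont] by simp
    have "norm (f (y k \<omega>)) \<le> norm (?b \<omega>)" for \<omega>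
    proof -
      have "0 \<le> L / 2 * (norm (y k \<omega> - z))\<^sup>2" using L_pos by simp
      then show ?thesis using z[of "y k \<omega>"] upper[of "y k \<omega>" z] unfolding real_norm_def by linarith
    qed
    then show "AE \<omega> in M. norm (f (y k \<omega>)) \<le> norm (?b \<omega>)" by simp
  qed
  have D_si: "square_integrable M (D k)" for k
    unfolding D_def
    by (intro square_integrable_diff square_integrable_add square_integrable_scaleR x_si y_si square_integrable_const)
  have V_int: "integrable M (V k)" for k
    unfolding V_def using f_int square_integrable_norm_square[OF D_si] by simp
  have e_si: "square_integrable M (e k)" for k
    unfolding e_def
    by (intro square_integrable_diff square_integrable_scaleR x_si y_si g_si square_integrable_const)
  have e_H: "e k \<in> borel_measurable (H k)" for k
    unfolding e_def using xy_H[of k] by measurable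
  have EV_step: "(\<integral>\<omega>. V (Suc k) \<omega> \<partial>M)
      \<le> (1 - \<gamma>) * (\<integral>\<omega>. V k \<omega> \<partial>M) + \<alpha> * \<nu>\<^sup>2 * (real k + 1) powr (- v)" for k
  proof -
    note int = V_int square_integrable_norm_square[OF w_si] integrable_inner_of_square_integrable[OF e_si w_si]
    have "(\<integral>\<omega>. V (Suc k) \<omega> \<partial>M)
        \<le> (\<integral>\<omega>. (1 - \<gamma>) * V k \<omega> + \<alpha> * (norm (w k \<omega>))\<^sup>2 + e k \<omega> \<bullet> w k \<omega> \<partial>M)"
      using int by (intro integral_mono V_step) auto
    also have "\<dots> = (1 - \<gamma>) * (\<integral>\<omega>. V k \<omega> \<partial>M) + \<alpha> * (\<integral>\<omega>. (norm (w k \<omega>))\<^sup>2 \<partial>M)"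
      using int w_orth[OF e_si e_H] by simp
    also have "\<dots> \<le> (1 - \<gamma>) * (\<integral>\<omega>. V k \<omega> \<partial>M) + \<alpha> * (\<nu>\<^sup>2 * (real k + 1) powr (- v))"
      using alpha w_le[of k] by (intro add_left_mono mult_left_mono) auto
    finally show ?thesis by (simp add: mult.assoc)
  qed
  have "\<exists>C>0. \<forall>k\<ge>1. (\<integral>\<omega>. V k \<omega> \<partial>M) \<le> C * real k powr (- v)"
    using \<gamma> alpha by (intro contraction_with_polynomial_forcing[OF EV_step]) auto
  moreover have "(\<integral>\<omega>. f (y k \<omega>) \<partial>M) - f z \<le> (\<integral>\<omega>. V k \<omega> \<partial>M)" for k
  proof -
    have "(\<integral>\<omega>. f (y k \<omega>) \<partial>M) - f z = (\<integral>\<omega>. f (y k \<omega>) - f z \<partial>M)"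
      using f_int by (simp add: prob_space)
    also have "\<dots> \<le> (\<integral>\<omega>. V k \<omega> \<partial>M)"
      using f_int V_int eta_pos by (intro integral_mono) (auto simp: V_def)
    finally show ?thesis .
  qed
  ultimately show ?thesis
    unfolding z_def[symmetric] using f_int by (meson order_trans)
qed

end
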